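(* Consider a normalized Hamburger moment problem with moments $(s_n)$ and recurrence coefficients $a_n\in\mathbb R$, $b_n>0$. Assume that $$\sum_{n=1}^\infty\frac{1+|a_n|}{\sqrt{b_nb_{n-1}}}<\infty,$$ and that there is $n_0\ge1$ such that either $b_n^2\le b_{n-1}b_{n+1}$ for all $n\ge n_0$, or $b_n^2\ge b_{n-1}b_{n+1}$ for all $n\ge n_0$ (so the problem is indeterminate). Let $$F(z)=\sum_{n=0}^\infty\frac{z^{2n}}{s_{2n}},\quad G(z)=\sum_{n=0}^\infty\frac{z^n}{b_n^n},\quad H(z)=\sum_{n=0}^\infty b_{n,n}z^n,\quad L(z)=\sum_{n=0}^\infty\frac{z^n}{\sqrt{s_{2n}}},$$ where $b_{n,n}=1/(b_0b_1\cdots b_{n-1})$ is the leading coefficient of the orthonormal polynomial $P_n$. Let $\rho,\rho^{[1]},\rho^{[2]}$ denote the order, logarithmic order and double logarithmic order of the moment problem. Then: (i) $\rho=\rho_F=\rho_G=\rho_H=\rho_L=\mathcal E(b_n)$. (ii) If $\rho=0$, then $\rho^{[1]}=\rho^{[1]}_F=\rho^{[1]}_G=\rho^{[1]}_H=\rho^{[1]}_L=\mathcal E(\log b_n)$. (iii) If $\rho^{[1]}=0$, then $\rho^{[2]}=\rho^{[2]}_F=\rho^{[2]}_G=\rho^{[2]}_H=\rho^{[2]}_L=\mathcal E(\log\log b_n)$.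
   Context: A normalized Hamburger moment problem is given by a sequence $s_n=\int_{-\infty}^\infty x^n\,d\mu(x)$, $n\ge0$, where $\mu$ is a probability measure on $\mathbb R$ with infinite support and moments of every order. It is indeterminate if more than one measure $\mu$ has these moments. Its orthonormal polynomials $P_n$ satisfy $zP_n(z)=b_nP_{n+1}(z)+a_nP_n(z)+b_{n-1}P_{n-1}(z)$, $n\ge0$, with $a_n\in\mathbb R$, $b_n>0$ for $n\ge 0$, $b_{-1}=1$, $P_0=1$, $P_{-1}=0$. Put $P(z)=(\sum_{n\ge0}|P_n(z)|^2)^{1/2}$, which is finite and continuous on $\mathbb C$ in the indeterminate case. Under the hypotheses of the claim $b_n\to\infty$ and $F,G,H,L$ are entire. For an unbounded continuous $f:\mathbb C\to\mathbb C$ let $M_f(r)=\max_{|z|\le r}|f(z)|$, and define (each with $\inf\emptyset=\infty$, "large" meaning sufficiently large) order: $\rho_f=\inf\{a>0\mid \log M_f(r)\le r^a\text{ for all large }r\}$; logarithmic order: $\rho^{[1]}_f=\inf\{a>0\mid M_f(r)\le r^{(\log r)^a}\text{ for all large }r\}$; double logarithmic order: $\rho^{[2]}_f=\inf\{a>0\mid M_f(r)\le r^{(\log\log r)^a}\text{ for all large }r\}$. The order $\rho$, logarithmic order $\rho^{[1]}$ and double logarithmic order $\rho^{[2]}$ of an indeterminate moment problem are those of $P$ (the function $(\sum_n|Q_n(z)|^2)^{1/2}$, with $Q_n$ the polynomials of the second kind, and the four entire Nevanlinna functions $A,B,C,D$ give the same values). For a sequence $(z_n)$ with $|z_n|\to\infty$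 (defined for sufficiently large $n$) the exponent of convergence is $\mathcal E(z_n)=\inf\{a>0\mid\sum_{n\ge n^*}|z_n|^{-a}<\infty\}$ ($\inf\emptyset=\infty$), where $n^*$ is such that $z_n$ is defined and $|z_n|>0$ for $n\ge n^*$. *)

theory Defs
  imports
    "HOL-Probability.Probability"
    "HOL-Computational_Algebra.Polynomial"
begin

section \<open>The Hamburger moment problem\<close>

definition has_moments :: "real measure \<Rightarrow> (nat \<Rightarrow> real) \<Rightarrow> bool" where
  "has_moments \<mu> s \<longleftrightarrow> sets \<mu> = sets borel \<and>
     (\<forall>n. integrable \<mu> (\<lambda>x. x ^ n) \<and> s n = (LINT x|\<mu>. x ^ n))"

definition measure_support :: "real measure \<Rightarrow> real set" where
  "measure_support \<mu> = {x. \<forall>U. open U \<longrightarrow> x \<in> U \<longrightarrow> emeasure \<mu> U > 0}"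

text \<open>The sequence \<open>s\<close> is a normalized Hamburger moment sequence, represented by \<open>\<mu>\<close>.\<close>

definition normalized_Hamburger :: "real measure \<Rightarrow> (nat \<Rightarrow> real) \<Rightarrow> bool" where
  "normalized_Hamburger \<mu> s \<longleftrightarrow>
     has_moments \<mu> s \<and> prob_space \<mu> \<and> infinite (measure_support \<mu>)"

definition indeterminate :: "(nat \<Rightarrow> real) \<Rightarrow> bool" where
  "indeterminate s \<longleftrightarrow> (\<exists>\<mu> \<nu>. has_moments \<mu> s \<and> has_moments \<nu> s \<and> \<mu> \<noteq> \<nu>)"

text \<open>The integrals below depend on \<open>\<mu>\<close> only through its moments, so the polynomials \<open>P n\<close>
  are determined by the moment sequence; the sign is fixed by a positive leading coefficient.\<close>

definition orthonormal_polys :: "real measure \<Rightarrow> (nat \<Rightarrow> real poly) \<Rightarrow> bool" where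
  "orthonormal_polys \<mu> P \<longleftrightarrow>
     (\<forall>n. degree (P n) = n \<and> lead_coeff (P n) > 0) \<and>
     (\<forall>m n. (LINT x|\<mu>. poly (P m) x * poly (P n) x) = (if m = n then 1 else 0))"

text \<open>The case distinction encodes the convention \<open>P\<^sub>-\<^sub>1 = 0\<close>.\<close>

definition recurrence_coeffs ::
  "(nat \<Rightarrow> real poly) \<Rightarrow> (nat \<Rightarrow> real) \<Rightarrow> (nat \<Rightarrow> real) \<Rightarrow> bool" where
  "recurrence_coeffs P a b \<longleftrightarrow>
     (\<forall>n. b n > 0) \<and>
     (\<forall>n. [:0, 1:] * P n =
        smult (b n) (P (Suc n)) + smult (a n) (P n) +
        (if n = 0 then 0 else smult (b (n - 1)) (P (n - 1))))"

definition P_fun :: "(nat \<Rightarrow> real poly) \<Rightarrow> complex \<Rightarrow> real" where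
  "P_fun P z = sqrt (\<Sum>n. (cmod (poly (map_poly complex_of_real (P n)) z))\<^sup>2)"


section \<open>Order, logarithmic order, double logarithmic order\<close>

text \<open>For continuous \<open>f\<close> the supremum is a maximum.\<close>

definition max_modulus :: "(complex \<Rightarrow> 'a::real_normed_vector) \<Rightarrow> real \<Rightarrow> real" where
  "max_modulus f r = (SUP z\<in>cball 0 r. norm (f z))"

text \<open>All orders are extended reals, with infimum \<open>\<infinity>\<close> for the empty set.\<close>

definition growth_order :: "(complex \<Rightarrow> 'a::real_normed_vector) \<Rightarrow> ereal" where
  "growth_order f = Inf (ereal ` {a. a > 0 \<and>
     (\<forall>\<^sub>F r in at_top. ln (max_modulus f r) \<le> r powr a)})"

definition log_order :: "(complex \<Rightarrow> 'a::real_normed_vector) \<Rightarrow> ereal" where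
  "log_order f = Inf (ereal ` {a. a > 0 \<and>
     (\<forall>\<^sub>F r in at_top. max_modulus f r \<le> r powr (ln r powr a))})"

definition loglog_order :: "(complex \<Rightarrow> 'a::real_normed_vector) \<Rightarrow> ereal" where
  "loglog_order f = Inf (ereal ` {a. a > 0 \<and>
     (\<forall>\<^sub>F r in at_top. max_modulus f r \<le> r powr (ln (ln r) powr a))})"

text \<open>A sequence that is meaningful only for large indices is represented by a total function;
  starting the sum at \<open>N\<close> makes the irrelevant initial values harmless.\<close>

definition conv_exponent :: "(nat \<Rightarrow> 'a::real_normed_vector) \<Rightarrow> ereal" where
  "conv_exponent z = Inf (ereal ` {a. a > 0 \<and>
     (\<exists>N. (\<forall>n\<ge>N. norm (z n) > 0) \<and> summable (\<lambda>n. norm (z (n + N)) powr (- a)))})"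


section \<open>The comparison functions\<close>

definition F_fun :: "(nat \<Rightarrow> real) \<Rightarrow> complex \<Rightarrow> complex" where
  "F_fun s z = (\<Sum>n. z ^ (2 * n) / of_real (s (2 * n)))"

definition G_fun :: "(nat \<Rightarrow> real) \<Rightarrow> complex \<Rightarrow> complex" where
  "G_fun b z = (\<Sum>n. z ^ n / of_real (b n ^ n))"

definition H_fun :: "(nat \<Rightarrow> real) \<Rightarrow> complex \<Rightarrow> complex" where
  "H_fun b z = (\<Sum>n. of_real (1 / (\<Prod>k<n. b k)) * z ^ n)"

definition L_fun :: "(nat \<Rightarrow> real) \<Rightarrow> complex \<Rightarrow> complex" where
  "L_fun s z = (\<Sum>n. z ^ n / of_real (sqrt (s (2 * n))))"

text \<open>The coefficients of \<open>H_fun\<close> are the leading coefficients of the orthonormal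
  polynomials.\<close>

lemma orthonormal_polys_0:
  assumes "normalized_Hamburger \<mu> s" "orthonormal_polys \<mu> P"
  shows "P 0 = 1"
proof -
  interpret prob_space \<mu>
    using assms(1) by (simp add: normalized_Hamburger_def)
  have deg: "degree (P 0) = 0" and pos: "lead_coeff (P 0) > 0"
    and int: "(LINT x|\<mu>. poly (P 0) x * poly (P 0) x) = 1"
    using assms(2) unfolding orthonormal_polys_def by (blast, blast, simp)
  obtain c where c: "P 0 = [:c:]"
    using deg by (metis degree_eq_zeroE)
  have "c * c = 1" "c > 0"
    using int pos by (simp_all add: c prob_space)
  then have "c = 1"
    by (auto simp: square_eq_1_iff)
  then show ?thesis by (simp add: c one_pCons)
qed

lemma lead_coeff_orthonormal_polys:
  assumes "normalized_Hamburger \<mu> s" "orthonormal_polys \<mu> P" "recurrence_coeffs P a b"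
  shows "lead_coeff (P n) = 1 / (\<Prod>k<n. b k)"
proof (induction n)
  case 0
  show ?case using orthonormal_polys_0[OF assms(1,2)] by simp
next
  case (Suc n)
  have deg: "degree (P k) = k" for k
    using assms(2) by (simp add: orthonormal_polys_def)
  have b: "b n > 0"
    using assms(3) by (simp add: recurrence_coeffs_def)
  have "coeff ([:0, 1:] * P n) (Suc n) =
      coeff (smult (b n) (P (Suc n)) + smult (a n) (P n) +
        (if n = 0 then 0 else smult (b (n - 1)) (P (n - 1)))) (Suc n)"
    using assms(3) by (simp only: recurrence_coeffs_def)
  also have "\<dots> = b n * coeff (P (Suc n)) (Suc n)"
    by (simp add: coeff_eq_0 deg)
  finally have "coeff (P n) n = b n * coeff (P (Suc n)) (Suc n)"
    by simp
  then have "coeff (P (Suc n)) (Suc n) = coeff (P n) n / b n"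
    using b by simp
  also have "\<dots> = 1 / (\<Prod>k<Suc n. b k)"
    using Suc by (simp add: deg)
  finally show ?case
    by (simp only: deg)
qed

end

theory Submission
  imports Defs "HOL-Real_Asymp.Real_Asymp" "HOL-Complex_Analysis.Complex_Analysis"
    "HOL-Computational_Algebra.Fundamental_Theorem_Algebra"
begin

text \<open>
  Both regularity assumptions make \<open>b\<close> eventually increasing, and the recurrence, weighted by
  \<open>sqrt (b (n - 1))\<close> or \<open>sqrt (b n)\<close>, bounds \<open>P_fun P z\<close> by a polynomial factor times
  \<open>\<Prod>k. 1 + K * \<bar>z\<bar> / b k\<close>, whose growth is governed by the convergence exponent of \<open>b\<close>.
  Conversely \<open>P_fun P\<close> dominates every term of \<open>H_fun b\<close> because the leading coefficient of \<open>P n\<close> is a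
  Taylor coefficient of \<open>H_fun b\<close>, the coefficients of \<open>G_fun b\<close> are at most those of \<open>H_fun b\<close> up to \<open>K ^ n\<close>,
  and a growth bound on \<open>G_fun b\<close> forces \<open>b n\<close> to be large, which closes the cycle. Expanding \<open>x ^ n\<close>
  in the orthonormal polynomials compares \<open>sqrt (s (2 * n))\<close> with \<open>b 0 * \<dots> * b (n - 1)\<close> up to a
  factor \<open>K ^ n\<close>, which brings in \<open>L_fun s\<close> and \<open>F_fun s\<close>.

  For indeterminacy, Gauss quadrature with a prescribed node \<open>x0\<close> gives, in the limit, a solution with
  mass at least \<open>1 / (P_fun P x0)\<^sup>2\<close> at \<open>x0\<close>, for all but countably many \<open>x0\<close>; a single measure cannot have
  so many atoms.
\<close>

section \<open>Growth scales\<close>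

text \<open>The three orders are infima of exponents \<open>a\<close> with
  \<open>max_modulus f r \<le> exp (T a r)\<close>. In each of the scales an arbitrarily small
  increase of \<open>a\<close> absorbs constants, polynomial factors, fixed powers and a dilation of
  \<open>r\<close>. Thus every comparison may lose a factor \<open>K ^ n\<close> in the
  coefficients, and one cycle of inequalities, proved for an abstract \<open>T\<close>, serves all
  three orders. Only the two links with the convergence exponent, from \<open>b\<close> to the
  product and from the coefficients of \<open>G_fun b\<close> back to \<open>b\<close>, depend on
  the scale; the locale \<open>matching_scale\<close> isolates them. The regularity hypothesis holds
  only from some index on, so \<open>b\<close> need not be monotone. Comparability up to a constant
  \<open>K\<close> from the start replaces monotonicity; its price is again a dilation. For
  indeterminacy the delicate point is the limit of the quadratures: weak convergence controls
  bounded test functions only, whereas monomials are unbounded. Truncation with an error governed by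
  the moment of twice the degree bridges this gap.\<close>

definition order_scale :: "real \<Rightarrow> real \<Rightarrow> real" where
  "order_scale a r = r powr a"

definition log_scale :: "(real \<Rightarrow> real) \<Rightarrow> real \<Rightarrow> real \<Rightarrow> real" where
  "log_scale \<psi> a r = ln r * \<psi> r powr a"

definition growth_scale :: "(real \<Rightarrow> real \<Rightarrow> real) \<Rightarrow> bool" where
  "growth_scale T \<longleftrightarrow> (\<forall>a a' A p q K. 0 < a \<longrightarrow> a < a' \<longrightarrow> 0 < K \<longrightarrow>
     (\<forall>\<^sub>F r in at_top. A + p * ln (1 + r) + q * T a (K * r) \<le> T a' r))"

text \<open>Writing the larger exponent as \<open>a + d\<close> leaves only sign conditions on
  single parameters, the form in which the asymptotic comparisons below can be decided.\<close>

lemma growth_scaleI: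
  assumes "\<And>a d A p q K. 0 < a \<Longrightarrow> 0 < d \<Longrightarrow> 0 < K \<Longrightarrow>
    \<forall>\<^sub>F r in at_top. A + p * ln (1 + r) + q * T a (K * r) \<le> T (a + d) r"
  shows "growth_scale T"
  unfolding growth_scale_def
proof (intro allI impI)
  fix a a' A p q K :: real
  assume *: "0 < a" "a < a'" "0 < K"
  then show "\<forall>\<^sub>F r in at_top. A + p * ln (1 + r) + q * T a (K * r) \<le> T a' r"
    using assms[of a "a' - a" K A p q] by simp
qed

lemma growth_scale_order: "growth_scale order_scale"
  by (rule growth_scaleI, unfold order_scale_def) real_asymp

lemma growth_scale_log: "growth_scale (log_scale ln)"
  by (rule growth_scaleI, unfold log_scale_def) real_asymp

lemma growth_scale_loglog: "growth_scale (log_scale (\<lambda>x. ln (ln x)))"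
  by (rule growth_scaleI, unfold log_scale_def) real_asymp

definition scale_order :: "(real \<Rightarrow> real \<Rightarrow> real) \<Rightarrow> (complex \<Rightarrow> 'a::real_normed_vector) \<Rightarrow> ereal" where
  "scale_order T f = Inf (ereal ` {a. a > 0 \<and>
     (\<forall>\<^sub>F r in at_top. max_modulus f r \<le> exp (T a r))})"

text \<open>Exponentiating a bound on \<open>ln (max_modulus f r)\<close> is reversible only where
  the maximum modulus is positive; the other two orders are defined without a logarithm of
  it.\<close>

lemma growth_order_eq_scale_order:
  assumes "\<forall>\<^sub>F r in at_top. max_modulus f r > 0"
  shows "growth_order f = scale_order order_scale f"
proof -
  have "(\<forall>\<^sub>F r in at_top. ln (max_modulus f r) \<le> r powr a) \<longleftrightarrow>
        (\<forall>\<^sub>F r in at_top. max_modulus f r \<le> exp (r powr a))" for a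
    by (rule eventually_cong[OF assms]) (metis exp_le_cancel_iff exp_ln)
  then show ?thesis
    by (simp add: growth_order_def scale_order_def order_scale_def)
qed

lemma log_order_eq_scale_order: "log_order f = scale_order (log_scale ln) f"
proof -
  have "(\<forall>\<^sub>F r in at_top. max_modulus f r \<le> r powr (ln r powr a)) \<longleftrightarrow>
        (\<forall>\<^sub>F r in at_top. max_modulus f r \<le> exp (ln r * ln r powr a))" for a
    by (rule eventually_cong[OF eventually_gt_at_top[of 0]]) (simp add: powr_def mult.commute)
  then show ?thesis
    by (simp add: log_order_def scale_order_def log_scale_def)
qed

lemma loglog_order_eq_scale_order: "loglog_order f = scale_order (log_scale (\<lambda>x. ln (ln x))) f"
proof -
  have "(\<forall>\<^sub>F r in at_top. max_modulus f r \<le> r powr (ln (ln r) powr a)) \<longleftrightarrow>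
        (\<forall>\<^sub>F r in at_top. max_modulus f r \<le> exp (ln r * ln (ln r) powr a))" for a
    by (rule eventually_cong[OF eventually_gt_at_top[of 0]]) (simp add: powr_def mult.commute)
  then show ?thesis
    by (simp add: loglog_order_def scale_order_def log_scale_def)
qed

text \<open>An infimum does not notice an arbitrarily small loss in the exponent; this is what lets
  all later estimates be wasteful.\<close>

lemma Inf_ereal_image_le:
  fixes A B :: "real set"
  assumes "\<And>a a'. a \<in> A \<Longrightarrow> a < a' \<Longrightarrow> a' \<in> B"
  shows "Inf (ereal ` B) \<le> Inf (ereal ` A)"
proof (rule Inf_greatest)
  fix x assume "x \<in> ereal ` A"
  then obtain a where a: "a \<in> A" "x = ereal a" by auto
  show "Inf (ereal ` B) \<le> x"
  proof (rule ereal_le_epsilon2)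
    fix e :: real assume "0 < e"
    with a assms[of a "a + e"] have "ereal (a + e) \<in> ereal ` B" by auto
    then show "Inf (ereal ` B) \<le> x + ereal e"
      using a by (simp add: Inf_lower)
  qed
qed

lemma eventually_at_top_mult_const:
  fixes K :: real
  assumes "\<forall>\<^sub>F r in at_top. Q r" "0 < K"
  shows "\<forall>\<^sub>F r in at_top. Q (K * r)"
  using assms filterlim_tendsto_pos_mult_at_top[OF tendsto_const assms(2) filterlim_ident]
  by (auto simp: filterlim_iff)

lemma exp_growth_scale_absorb:
  assumes T: "growth_scale T" and a: "0 < a" "a < a'" and K: "0 < K" and C: "0 < C"
    and g: "\<forall>\<^sub>F r in at_top. g r \<le> exp (T a r)" and g0: "\<And>r. 0 \<le> r \<Longrightarrow> 0 \<le> g r"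
  shows "\<forall>\<^sub>F r in at_top. C * (1 + r) ^ p * g (K * r) ^ q \<le> exp (T a' r)"
proof -
  have "\<forall>\<^sub>F r in at_top. ln C + real p * ln (1 + r) + real q * T a (K * r) \<le> T a' r"
    using T a K unfolding growth_scale_def by blast
  then show ?thesis
    using eventually_at_top_mult_const[OF g K] eventually_ge_at_top[of 0]
  proof eventually_elim
    case (elim r)
    have "C * (1 + r) ^ p * g (K * r) ^ q \<le> C * (1 + r) ^ p * exp (T a (K * r)) ^ q"
      using elim C K g0[of "K * r"] by (intro mult_left_mono power_mono) auto
    also have "\<dots> = exp (ln C + real p * ln (1 + r) + real q * T a (K * r))"
      using elim C by (simp add: exp_add exp_of_nat_mult)
    also have "\<dots> \<le> exp (T a' r)"
      using elim by simp
    finally show ?case .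
  qed
qed

text \<open>\<open>K\<close> stands for a factor \<open>K ^ n\<close> in the coefficients,
  \<open>C\<close> for the sum of a geometric series; the power \<open>q\<close> is there for
  \<open>F_fun s\<close>, which is bounded by the square of \<open>L_fun s\<close>.\<close>

lemma scale_order_mono:
  fixes f :: "complex \<Rightarrow> 'a::real_normed_vector" and g :: "complex \<Rightarrow> 'b::real_normed_vector"
  assumes T: "growth_scale T" and C: "0 < C" and K: "0 < K"
    and le: "\<forall>\<^sub>F r in at_top. max_modulus f r \<le> C * max_modulus g (K * r) ^ q"
    and g0: "\<And>r. 0 \<le> r \<Longrightarrow> 0 \<le> max_modulus g r"
  shows "scale_order T f \<le> scale_order T g"
  unfolding scale_order_def
proof (rule Inf_ereal_image_le, safe)
  fix a a' :: real
  assume a: "0 < a" "a < a'" and *: "\<forall>\<^sub>F r in at_top. max_modulus g r \<le> exp (T a r)"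
  show "0 < a'" using a by simp
  have "\<forall>\<^sub>F r in at_top. C * (1 + r) ^ 0 * max_modulus g (K * r) ^ q \<le> exp (T a' r)"
    by (rule exp_growth_scale_absorb[OF T a K C *]) (rule g0)
  with le show "\<forall>\<^sub>F r in at_top. max_modulus f r \<le> exp (T a' r)"
    by eventually_elim simp
qed

section \<open>Almost increasing sequences\<close>

locale almost_increasing =
  fixes b :: "nat \<Rightarrow> real" and K :: real
  assumes pos: "0 < b n" and K: "1 \<le> K" and mono: "k \<le> j \<Longrightarrow> b k \<le> K * b j"
    and summable_inverse: "summable (\<lambda>n. 1 / b n)"
begin

lemma at_top_sequence: "filterlim b at_top sequentially"
proof -
  have "(\<lambda>n. inverse (b n)) \<longlonglongrightarrow> 0"
    using summable_LIMSEQ_zero[OF summable_inverse] by (simp add: field_simps)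
  then have "filterlim (\<lambda>n. inverse (inverse (b n))) at_top sequentially"
    by (rule filterlim_inverse_at_top) (simp add: pos)
  then show ?thesis by simp
qed

text \<open>Logarithm of the canonical product of genus zero with zeros at the points
  \<open>- b k\<close>, taken on the positive axis, where its modulus is largest.\<close>

definition log_product :: "real \<Rightarrow> real" where
  "log_product r = (\<Sum>k. ln (1 + r / b k))"

lemma summable_log_product:
  assumes "0 \<le> r" shows "summable (\<lambda>k. ln (1 + r / b k))"
proof (rule summable_comparison_test)
  have "ln (1 + r / b k) \<le> r * (1 / b k)" for k
    using assms pos[of k] ln_add_one_self_le_self[of "r / b k"] by simp
  moreover have "0 \<le> ln (1 + r / b k)" for k
    using assms pos[of k] by simp
  ultimately show "\<exists>N. \<forall>n\<ge>N. norm (ln (1 + r / b n)) \<le> r * (1 / b n)"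
    by simp
  show "summable (\<lambda>n. r * (1 / b n))"
    by (intro summable_mult summable_inverse)
qed

lemma log_product_nonneg: "0 \<le> r \<Longrightarrow> 0 \<le> log_product r"
  unfolding log_product_def using pos
  by (intro suminf_nonneg summable_log_product) (auto simp: less_imp_le)

lemma log_product_mono: "0 \<le> r \<Longrightarrow> r \<le> r' \<Longrightarrow> log_product r \<le> log_product r'"
  unfolding log_product_def
proof (intro suminf_le summable_log_product)
  fix n assume r: "0 \<le> r" "r \<le> r'"
  have "r / b n \<le> r' / b n" using r pos[of n] by (intro divide_right_mono) auto
  then show "ln (1 + r / b n) \<le> ln (1 + r' / b n)"
    using r pos[of n] by (subst ln_le_cancel_iff) (auto intro!: add_pos_nonneg divide_nonneg_pos)
qed auto

lemma lower_bound: "b 0 / K \<le> b k"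
  using mono[of 0 k] K by (simp add: field_simps)

end

text \<open>For \<open>x > 1\<close> the bound \<open>ln x \<le> x powr a / a\<close> is decisive,
  for smaller \<open>x\<close> it is \<open>x \<le> x powr a\<close>. Summed over
  \<open>r / b n\<close>, this makes the logarithm of the product at most a multiple of
  \<open>r powr a\<close>.\<close>

lemma ln_one_plus_le_powr:
  fixes x a :: real
  assumes "0 \<le> x" "0 < a" "a \<le> 1"
  shows "ln (1 + x) \<le> (1 + 1 / a) * x powr a"
proof (cases "x \<le> 1")
  case True
  have "ln (1 + x) \<le> x" using assms by (intro ln_add_one_self_le_self)
  also have "x \<le> x powr a"
    using powr_mono'[of a 1 x] assms True by (cases "x = 0") auto
  also have "\<dots> \<le> (1 + 1 / a) * x powr a"
    using assms by (simp add: algebra_simps)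
  finally show ?thesis .
next
  case False
  have 1: "ln (1 + x) \<le> ln (2 * x)" using False by simp
  have 2: "ln (2 * x) = ln 2 + ln x" using False by (simp add: ln_mult)
  have 3: "ln 2 \<le> x powr a" using ge_one_powr_ge_zero[of x a] ln_le_minus_one[of 2] False assms by auto
  have "ln (x powr a) \<le> x powr a"
    using False ln_le_minus_one[of "x powr a"] by auto
  then have 4: "ln x \<le> x powr a / a"
    using False assms by (simp add: ln_powr field_simps)
  show ?thesis using 1 2 3 4 by (simp add: algebra_simps)
qed

section \<open>Convergence exponents and the scales that match them\<close>

definition conv_set :: "(nat \<Rightarrow> 'a::real_normed_vector) \<Rightarrow> real set" where
  "conv_set z = {a. a > 0 \<and>
     (\<exists>N. (\<forall>n\<ge>N. norm (z n) > 0) \<and> summable (\<lambda>n. norm (z (n + N)) powr (- a)))}"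

lemma conv_exponent_eq: "conv_exponent z = Inf (ereal ` conv_set z)"
  by (simp add: conv_exponent_def conv_set_def)

text \<open>Comparison with \<open>n powr (- (a' / a))\<close>, which is summable because
  \<open>a' / a > 1\<close>.\<close>

lemma conv_setI:
  fixes z :: "nat \<Rightarrow> real"
  assumes a: "0 < a" "a < a'" and c: "0 < c"
    and le: "\<forall>\<^sub>F n in sequentially. c * real n powr (1 / a) \<le> z n"
  shows "a' \<in> conv_set z"
proof -
  obtain N where N: "\<And>n. n \<ge> N \<Longrightarrow> c * real n powr (1 / a) \<le> z n"
    using le unfolding eventually_sequentially by blast
  \<comment> \<open>Index \<open>0\<close> is skipped because \<open>0 powr (1 / a)\<close> is
    \<open>0\<close> and gives no positive lower bound.\<close>
  define M where "M = Suc N"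
  have lb: "0 < c * real n powr (1 / a)" "c * real n powr (1 / a) \<le> z n" if "n \<ge> M" for n
    using that c N[of n] by (auto simp: M_def)
  have "summable (\<lambda>n. c powr (- a') * real n powr (- (a' / a)))"
    using a by (intro summable_mult) (simp add: summable_real_powr_iff)
  then have "summable (\<lambda>n. norm (z n) powr (- a'))"
  proof (rule summable_comparison_test_ev[rotated])
    show "\<forall>\<^sub>F n in sequentially. norm (norm (z n) powr - a') \<le> c powr - a' * real n powr - (a' / a)"
      using eventually_ge_at_top[of M]
    proof eventually_elim
      case (elim n)
      have "z n powr (- a') \<le> (c * real n powr (1 / a)) powr (- a')"
        using lb[OF elim] a by (intro powr_mono2') auto
      also have "\<dots> = c powr - a' * real n powr - (a' / a)"
        using c by (simp add: powr_mult powr_powr)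
      finally show ?case using lb[OF elim] by simp
    qed
  qed
  then have "summable (\<lambda>n. norm (z (n + M)) powr (- a'))"
    by (subst summable_iff_shift)
  then show ?thesis
    using a lb unfolding conv_set_def by fastforce
qed

text \<open>The two halves of the dictionary between growth and convergence exponent:
  \<open>product_le\<close> bounds the product that majorizes \<open>P_fun P\<close>,
  \<open>conv_setI_coeff\<close> starts from the single terms of \<open>G_fun b\<close>.
  \<open>\<psi>\<close> will be the identity, \<open>ln\<close> or the iterated
  \<open>ln\<close>.\<close>

locale matching_scale =
  fixes T :: "real \<Rightarrow> real \<Rightarrow> real" and \<psi> :: "real \<Rightarrow> real"
  assumes scale: "growth_scale T"
    and product_le: "almost_increasing b K \<Longrightarrow> a \<in> conv_set (\<lambda>n. \<psi> (b n)) \<Longrightarrow> a < a' \<Longrightarrow>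
      \<forall>\<^sub>F r in at_top. almost_increasing.log_product b r \<le> T a' r"
    and conv_setI_coeff: "almost_increasing b K \<Longrightarrow> 0 < a \<Longrightarrow>
      (\<forall>\<^sub>F r in at_top. \<forall>n. (r / b n) ^ n \<le> exp (T a r)) \<Longrightarrow> a < a' \<Longrightarrow>
      a' \<in> conv_set (\<lambda>n. \<psi> (b n))"

lemma matching_scale_order: "matching_scale order_scale (\<lambda>x. x)"
proof
  show "growth_scale order_scale" by (rule growth_scale_order)
next
  fix b :: "nat \<Rightarrow> real" and K a a' :: real
  assume ai: "almost_increasing b K" and a: "a \<in> conv_set b" "a < a'"
  interpret almost_increasing b K by fact
  \<comment> \<open>The power bound for the logarithm needs an exponent at most \<open>1\<close>;
    passing to \<open>min a 1\<close> keeps summability since \<open>1 / b n\<close> is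
    summable.\<close>
  define c where "c = min a 1"
  obtain N where a0: "a > 0" and "summable (\<lambda>n. norm (b (n + N)) powr (- a))"
    using a by (auto simp: conv_set_def)
  then have "summable (\<lambda>n. b n powr (- a))"
    using pos by (subst (asm) summable_iff_shift) (simp add: less_imp_le)
  moreover have "summable (\<lambda>n. b n powr (- 1))"
    using summable_inverse pos by (simp add: powr_minus_divide less_imp_le)
  ultimately have S: "summable (\<lambda>n. b n powr (- c))"
    by (auto simp: c_def min_def)
  have c: "0 < c" "c \<le> 1" "c < a'" using a a0 by (auto simp: c_def)
  define S where "S = (\<Sum>n. (1 + 1 / c) * b n powr (- c))"
  have W: "log_product r \<le> S * r powr c" if "0 \<le> r" for r
  proof -
    have "log_product r \<le> (\<Sum>n. (1 + 1 / c) * b n powr (- c) * r powr c)"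
      unfolding log_product_def
    proof (rule suminf_le)
      show "ln (1 + r / b n) \<le> (1 + 1 / c) * b n powr (- c) * r powr c" for n
        using ln_one_plus_le_powr[of "r / b n" c] c that pos[of n]
        by (simp add: powr_divide powr_minus_divide)
      show "summable (\<lambda>n. ln (1 + r / b n))" by (rule summable_log_product) fact
      show "summable (\<lambda>n. (1 + 1 / c) * b n powr (- c) * r powr c)"
        by (intro summable_mult summable_mult2 S)
    qed
    also have "\<dots> = S * r powr c"
      unfolding S_def by (rule suminf_mult2[symmetric]) (intro summable_mult S)
    finally show ?thesis .
  qed
  have "\<forall>\<^sub>F r in at_top. 0 + 0 * ln (1 + r) + S * order_scale c (1 * r) \<le> order_scale a' r"
    using growth_scale_order c unfolding growth_scale_def by (metis zero_less_one)
  then show "\<forall>\<^sub>F r in at_top. log_product r \<le> order_scale a' r"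
    using eventually_ge_at_top[of 0]
    by eventually_elim (use W in \<open>force simp: order_scale_def\<close>)
next
  fix b :: "nat \<Rightarrow> real" and K a a' :: real
  assume ai: "almost_increasing b K" and a: "0 < a" "a < a'"
    and ev: "\<forall>\<^sub>F r in at_top. \<forall>n. (r / b n) ^ n \<le> exp (order_scale a r)"
  interpret almost_increasing b K by fact
  \<comment> \<open>The bound is used at \<open>r = n powr (1 / a)\<close>, where the scale equals
    \<open>n\<close>: the n-th root of \<open>exp n\<close> is the constant
    \<open>exp 1\<close>.\<close>
  have "filterlim (\<lambda>n. real n powr (1 / a)) at_top sequentially"
    using a by real_asymp
  then have "\<forall>\<^sub>F n in sequentially. \<forall>m. (real n powr (1/a) / b m) ^ m \<le> exp (order_scale a (real n powr (1/a)))"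
    using ev unfolding filterlim_iff by blast
  then have "\<forall>\<^sub>F n in sequentially. exp (-1) * real n powr (1 / a) \<le> b n"
    using eventually_gt_at_top[of 0]
  proof eventually_elim
    case (elim n)
    then have "(real n powr (1/a) / b n) ^ n \<le> exp (order_scale a (real n powr (1/a)))"
      by blast
    also have "order_scale a (real n powr (1/a)) = real n * 1"
      using a by (simp add: order_scale_def powr_powr)
    also have "exp (real n * 1) = exp 1 ^ n" by (rule exp_of_nat_mult)
    finally have "real n powr (1/a) / b n \<le> exp 1"
      using elim by (subst (asm) power_mono_iff) (auto simp: pos less_imp_le)
    then show ?case using pos[of n] by (simp add: field_simps exp_minus)
  qed
  then show "a' \<in> conv_set b"
    using a by (intro conv_setI[where c = "exp (-1)"]) auto
qed

text \<open>Collects what \<open>ln\<close> and its iterate share. \<open>weight_sqrt\<close> makes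
  \<open>b n powr (-1/2)\<close> summable along with \<open>\<psi> (b n) powr (- a)\<close>,
  \<open>weight_absorb\<close> swallows the resulting product bound, and \<open>weight_half\<close>
  says that passing to a square root costs at most a factor \<open>2\<close>. The function
  \<open>g\<close> allows a radius to be chosen by its weight.\<close>

locale log_weight =
  fixes \<psi> g :: "real \<Rightarrow> real"
  assumes weight_scale: "growth_scale (log_scale \<psi>)"
    and weight_mono: "\<forall>\<^sub>F x in at_top. 0 < \<psi> x \<and> (\<forall>y\<ge>x. \<psi> x \<le> \<psi> y)"
    and weight_sqrt: "0 < a \<Longrightarrow> \<forall>\<^sub>F x in at_top. x powr (-1/2) \<le> \<psi> x powr (- a)"
    and weight_absorb: "0 < a \<Longrightarrow> 0 < d \<Longrightarrow> 0 < \<beta> \<Longrightarrow>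
      \<forall>\<^sub>F r in at_top. ln (1 + r / \<beta>) * (m + S * \<psi> (r\<^sup>2) powr a) + B \<le> log_scale \<psi> (a + d) r"
    and weight_half: "\<forall>\<^sub>F x in at_top. \<psi> x / 2 \<le> \<psi> (x powr (1/2))"
    and inv: "\<psi> (g t) = t" and inv_at_top: "filterlim g at_top at_top"
begin

text \<open>The product is split at \<open>b n = r\<^sup>2\<close>: below, a term is absorbed into the convergent series
  of \<open>\<psi> (b n) powr (- a)\<close>; above, it is at most \<open>r / b n \<le> b n powr (-1/2)\<close>.\<close>

lemma matching_scale_log: "matching_scale (log_scale \<psi>) \<psi>"
proof
  show "growth_scale (log_scale \<psi>)" by (rule weight_scale)
next
  fix b :: "nat \<Rightarrow> real" and K a a' :: real
  assume ai: "almost_increasing b K" and a: "a \<in> conv_set (\<lambda>n. \<psi> (b n))" "a < a'"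
  interpret almost_increasing b K by fact
  obtain N where a0: "a > 0" and "summable (\<lambda>n. norm (\<psi> (b (n + N))) powr (- a))"
    using a by (auto simp: conv_set_def)
  then have S: "summable (\<lambda>n. \<bar>\<psi> (b n)\<bar> powr (- a))"
    by (subst (asm) summable_iff_shift) simp
  have "\<forall>\<^sub>F n in sequentially. (0 < \<psi> (b n) \<and> (\<forall>y\<ge>b n. \<psi> (b n) \<le> \<psi> y)) \<and>
      b n powr (-1/2) \<le> \<psi> (b n) powr (- a)"
    using at_top_sequence eventually_conj[OF weight_mono weight_sqrt[OF a0]] 
    unfolding filterlim_iff by blast
  then obtain M where M: "\<And>n. n \<ge> M \<Longrightarrow> 0 < \<psi> (b n)"
      "\<And>n y. n \<ge> M \<Longrightarrow> b n \<le> y \<Longrightarrow> \<psi> (b n) \<le> \<psi> y"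
      "\<And>n. n \<ge> M \<Longrightarrow> b n powr (-1/2) \<le> \<psi> (b n) powr (- a)"
    unfolding eventually_sequentially by blast
  \<comment> \<open>A positive lower bound for all \<open>b k\<close>, so that \<open>l\<close>
    below dominates every single logarithm.\<close>
  define \<beta> where "\<beta> = b 0 / K"
  have \<beta>: "0 < \<beta>" "\<beta> \<le> b k" for k
    using pos[of 0] K lower_bound[of k] by (auto simp: \<beta>_def)
  have S2: "summable (\<lambda>n. b n powr (-1/2))"
  proof (rule summable_comparison_test_ev[OF _ S])
    show "\<forall>\<^sub>F n in sequentially. norm (b n powr (- 1 / 2)) \<le> \<bar>\<psi> (b n)\<bar> powr - a"
      using eventually_ge_at_top[of M]
    proof eventually_elim
      case (elim n)
      then show ?case using M(1,3)[of n] by simp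
    qed
  qed
  define S where "S = (\<Sum>n. \<bar>\<psi> (b n)\<bar> powr (- a))"
  define B where "B = (\<Sum>n. b n powr (-1/2))"
  have W: "log_product r \<le> ln (1 + r / \<beta>) * (real M + S * \<psi> (r\<^sup>2) powr a) + B" if "0 < r" for r
  proof -
    define l where "l = ln (1 + r / \<beta>)"
    have l0: "0 \<le> l" using \<beta>(1) that by (simp add: l_def)
    have le_l: "ln (1 + r / b n) \<le> l" for n
      using \<beta> that pos[of n] unfolding l_def
      by (subst ln_le_cancel_iff) (auto intro!: divide_left_mono add_pos_pos)
    define v where "v n = l * \<psi> (r\<^sup>2) powr a * \<bar>\<psi> (b n)\<bar> powr (- a) + b n powr (-1/2)" for n
    have v0: "0 \<le> v n" for n using l0 by (simp add: v_def)
    have le_v: "ln (1 + r / b n) \<le> v n" if n: "n \<ge> M" for n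
    proof (cases "b n \<le> r\<^sup>2")
      case True
      have "l * 1 \<le> l * (\<psi> (r\<^sup>2) powr a * \<psi> (b n) powr (- a))"
      proof (rule mult_left_mono[OF _ l0])
        have "\<psi> (b n) powr a \<le> \<psi> (r\<^sup>2) powr a"
          using M(1)[OF n] M(2)[OF n True] a0 by (intro powr_mono2) auto
        then show "1 \<le> \<psi> (r\<^sup>2) powr a * \<psi> (b n) powr (- a)"
          using M(1)[OF n] by (simp add: powr_minus_divide)
      qed
      then have "l \<le> v n" using M(1)[OF n] by (simp add: v_def algebra_simps add_increasing)
      with le_l show ?thesis by (rule order_trans)
    next
      case False
      then have "r \<le> sqrt (b n)"
        using \<open>0 < r\<close> by (intro real_le_rsqrt) simp
      have "ln (1 + r / b n) \<le> r / b n"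
        using \<open>0 < r\<close> pos[of n] by (intro ln_add_one_self_le_self) simp
      also have "\<dots> \<le> sqrt (b n) / b n"
        using \<open>r \<le> sqrt (b n)\<close> pos[of n] by (intro divide_right_mono) auto
      also have "\<dots> = b n powr (-1/2)"
        using pos[of n] by (simp add: powr_minus_divide powr_half_sqrt real_div_sqrt field_simps)
      also have "\<dots> \<le> v n" using l0 by (simp add: v_def)
      finally show ?thesis .
    qed
    have sS: "summable (\<lambda>n. l * \<psi> (r\<^sup>2) powr a * \<bar>\<psi> (b n)\<bar> powr (- a))"
      by (intro summable_mult S)
    have sv: "summable v" "suminf v = l * \<psi> (r\<^sup>2) powr a * S + B"
      using summable_add[OF sS S2] suminf_add[OF sS S2] suminf_mult[OF S]
      by (simp_all only: v_def[abs_def] S_def B_def)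
    have sh: "summable (\<lambda>k. ln (1 + r / b k))"
      using that by (intro summable_log_product) simp
    \<comment> \<open>The first \<open>M\<close> terms, where \<open>\<psi> (b k)\<close> may fail
      to be positive, are counted with the crude bound \<open>l\<close> each.\<close>
    have "log_product r = (\<Sum>k. ln (1 + r / b (k + M))) + (\<Sum>k<M. ln (1 + r / b k))"
      unfolding log_product_def using suminf_split_initial_segment[OF sh] .
    also have "(\<Sum>k<M. ln (1 + r / b k)) \<le> real (card {..<M}) * l"
      by (rule sum_bounded_above) (rule le_l)
    also have "(\<Sum>k. ln (1 + r / b (k + M))) \<le> (\<Sum>k. v (k + M))"
      by (intro suminf_le le_v summable_ignore_initial_segment[OF sh]
          summable_ignore_initial_segment[OF sv(1)]) simp
    also have "\<dots> \<le> suminf v"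
      using suminf_split_initial_segment[OF sv(1), of M] sum_nonneg[of "{..<M}" v] v0 by simp
    finally show ?thesis
      unfolding sv l_def by (simp add: algebra_simps)
  qed
  have "\<forall>\<^sub>F r in at_top. ln (1 + r / \<beta>) * (real M + S * \<psi> (r\<^sup>2) powr a) + B \<le> log_scale \<psi> (a + (a' - a)) r"
    using a0 a \<beta>(1) by (intro weight_absorb) auto
  then show "\<forall>\<^sub>F r in at_top. log_product r \<le> log_scale \<psi> a' r"
    using eventually_gt_at_top[of 0]
    by eventually_elim (use W in force)
next
  fix b :: "nat \<Rightarrow> real" and K a a' :: real
  assume ai: "almost_increasing b K" and a: "0 < a" "a < a'"
    and ev: "\<forall>\<^sub>F r in at_top. \<forall>n. (r / b n) ^ n \<le> exp (log_scale \<psi> a r)"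
  interpret almost_increasing b K by fact
  \<comment> \<open>With \<open>r = g (t n)\<close> the scale is \<open>n * (ln r / 2)\<close>, so
    the bound reads \<open>(r / b n) ^ n \<le> (r powr (1/2)) ^ n\<close> and yields
    \<open>r powr (1/2) \<le> b n\<close>.\<close>
  define t where "t n = (real n / 2) powr (1 / a)" for n
  have "filterlim t at_top sequentially"
    unfolding t_def using a by real_asymp
  then have G: "filterlim (\<lambda>n. g (t n)) at_top sequentially"
    by (rule filterlim_compose[OF inv_at_top])
  have "filterlim (\<lambda>x::real. x powr (1/2)) at_top at_top" by real_asymp
  from filterlim_iff[THEN iffD1, OF this, rule_format, OF weight_mono]
  have "\<forall>\<^sub>F x in at_top. \<forall>y\<ge>x powr (1/2). \<psi> (x powr (1/2)) \<le> \<psi> y"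
    by (rule eventually_mono) blast
  then have "\<forall>\<^sub>F x in at_top. (\<forall>n. (x / b n) ^ n \<le> exp (log_scale \<psi> a x)) \<and> 0 < x \<and>
     (\<forall>y\<ge>x powr (1/2). \<psi> (x powr (1/2)) \<le> \<psi> y) \<and> \<psi> x / 2 \<le> \<psi> (x powr (1/2))"
    using ev weight_half eventually_gt_at_top[of 0] by eventually_elim blast
  from filterlim_iff[THEN iffD1, OF G, rule_format, OF this]
  have "\<forall>\<^sub>F n in sequentially. (1/2) powr (1/a) / 2 * real n powr (1 / a) \<le> \<psi> (b n)"
    using eventually_gt_at_top[of 0]
  proof eventually_elim
    case (elim n)
    define r where "r = g (t n)"
    have r: "0 < r" "\<And>y. y \<ge> r powr (1/2) \<Longrightarrow> \<psi> (r powr (1/2)) \<le> \<psi> y" "t n / 2 \<le> \<psi> (r powr (1/2))"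
      using elim by (auto simp: r_def inv)
    have "(r / b n) ^ n \<le> exp (log_scale \<psi> a r)"
      using elim by (auto simp: r_def)
    also have "log_scale \<psi> a r = real n * (ln r / 2)"
      using a by (simp add: log_scale_def r_def inv t_def powr_powr)
    also have "exp (real n * (ln r / 2)) = (r powr (1/2)) ^ n"
      using r by (subst exp_of_nat_mult) (simp add: powr_def)
    finally have "r / b n \<le> r powr (1/2)"
      using elim r by (subst (asm) power_mono_iff) (auto simp: pos less_imp_le)
    moreover have "r = r powr (1/2) * r powr (1/2)"
      using r by (simp add: powr_add[symmetric])
    ultimately have "r powr (1/2) * r powr (1/2) \<le> r powr (1/2) * b n"
      using pos[of n] by (simp add: field_simps)
    then have "r powr (1/2) \<le> b n"
      using r by simp
    with r have "t n / 2 \<le> \<psi> (b n)" by force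
    then show ?case by (simp add: t_def powr_divide powr_mult)
  qed
  then show "a' \<in> conv_set (\<lambda>n. \<psi> (b n))"
    using a by (intro conv_setI[where c = "(1/2) powr (1/a) / 2"]) auto
qed

end

lemma log_weight_ln: "log_weight ln exp"
proof
  show "growth_scale (log_scale ln)" by (rule growth_scale_log)
  show "\<forall>\<^sub>F x::real in at_top. 0 < ln x \<and> (\<forall>y\<ge>x. ln x \<le> ln y)"
    using eventually_gt_at_top[of 1] by eventually_elim auto
  show "\<forall>\<^sub>F x in at_top. x powr (-1/2) \<le> ln x powr (- a)" if "0 < a" for a :: real
    using that by real_asymp
  show "\<forall>\<^sub>F r in at_top. ln (1 + r / \<beta>) * (m + S * ln (r\<^sup>2) powr a) + B \<le> log_scale ln (a + d) r"
    if "0 < a" "0 < d" "0 < \<beta>" for a d \<beta> m S B :: real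
    using that unfolding log_scale_def by real_asymp
  show "\<forall>\<^sub>F x::real in at_top. ln x / 2 \<le> ln (x powr (1/2))"
    using eventually_gt_at_top[of 0] by eventually_elim (simp add: ln_powr)
qed (auto simp: exp_at_top)

lemma log_weight_ln_ln: "log_weight (\<lambda>x. ln (ln x)) (\<lambda>x. exp (exp x))"
proof
  show "growth_scale (log_scale (\<lambda>x. ln (ln x)))" by (rule growth_scale_loglog)
  show "\<forall>\<^sub>F x::real in at_top. 0 < ln (ln x) \<and> (\<forall>y\<ge>x. ln (ln x) \<le> ln (ln y))"
    using eventually_gt_at_top[of "exp 1"]
  proof eventually_elim
    case (elim x)
    have x0: "0 < x" using elim by (rule order.strict_trans[OF exp_gt_zero])
    have x: "1 < ln x" using elim x0 by (metis exp_less_cancel_iff exp_ln)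
    have "ln (ln x) \<le> ln (ln y)" if "x \<le> y" for y
    proof -
      have "ln x \<le> ln y" using that x0 by simp
      then show ?thesis using x by simp
    qed
    then show ?case using x by simp
  qed
  show "\<forall>\<^sub>F x in at_top. x powr (-1/2) \<le> ln (ln x) powr (- a)" if "0 < a" for a :: real
    using that by real_asymp
  show "\<forall>\<^sub>F r in at_top. ln (1 + r / \<beta>) * (m + S * ln (ln (r\<^sup>2)) powr a) + B \<le> log_scale (\<lambda>x. ln (ln x)) (a + d) r"
    if "0 < a" "0 < d" "0 < \<beta>" for a d \<beta> m S B :: real
    using that unfolding log_scale_def by real_asymp
  show "\<forall>\<^sub>F x::real in at_top. ln (ln x) / 2 \<le> ln (ln (x powr (1/2)))"
    by real_asymp
  show "filterlim (\<lambda>x::real. exp (exp x)) at_top at_top" by real_asymp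
qed auto

section \<open>Consequences of log-convexity and log-concavity\<close>

lemma sqrt_mult_le:
  fixes x y K :: real
  assumes "0 < y" "1 \<le> K" "x \<le> K * y"
  shows "sqrt (y * x) \<le> K * y"
proof (rule real_le_lsqrt)
  have "y * x \<le> y * (K * y)"
    using assms by (intro mult_left_mono) auto
  also have "\<dots> \<le> y * (K * y) * K"
    using assms by simp
  finally show "y * x \<le> (K * y)\<^sup>2"
    by (simp add: power2_eq_square algebra_simps)
qed (use assms in auto)

text \<open>\<open>K\<close> is the ratio of the largest to the smallest value on the initial
  segment \<open>{..m}\<close>, whose minimum bounds the whole sequence from below. Comparability
  turns the summability of \<open>1 / sqrt (b (Suc n) * b n)\<close> into that of
  \<open>1 / b n\<close>.\<close>

lemma almost_increasing_if_eventually_incseq: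
  fixes b :: "nat \<Rightarrow> real"
  assumes pos: "\<And>n. 0 < b n"
    and inc: "\<And>n. n \<ge> m \<Longrightarrow> b n \<le> b (Suc n)"
    and sum: "summable (\<lambda>n. 1 / sqrt (b (Suc n) * b n))"
  shows "\<exists>K. almost_increasing b K"
proof -
  define M where "M = Max (b ` {..m})"
  define \<delta> where "\<delta> = Min (b ` {..m})"
  have Mb: "\<And>k. k \<le> m \<Longrightarrow> b k \<le> M" and \<delta>b: "\<And>k. k \<le> m \<Longrightarrow> \<delta> \<le> b k"
    unfolding M_def \<delta>_def by auto
  have "\<delta> \<in> b ` {..m}"
    unfolding \<delta>_def by (intro Min_in) auto
  then have \<delta>: "0 < \<delta>" using pos by auto
  have mono: "b k \<le> b j" if "m \<le> k" "k \<le> j" for k j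
    using that(2)
  proof (induction j rule: dec_induct)
    case (step j)
    with inc[of j] that(1) show ?case by simp
  qed simp
  have \<delta>b': "\<delta> \<le> b k" for k
    using \<delta>b[of k] \<delta>b[of m] mono[of m k] by (cases "k \<le> m") auto
  define K where "K = M / \<delta>"
  have K: "1 \<le> K"
    using Mb[of m] \<delta>b[of m] \<delta> by (simp add: K_def)
  have al: "b k \<le> K * b j" if "k \<le> j" for k j
  proof (cases "k \<le> m")
    case True
    have "b k \<le> K * \<delta>" using Mb[OF True] \<delta> by (simp add: K_def)
    also have "\<dots> \<le> K * b j" using K \<delta>b'[of j] by (intro mult_left_mono) auto
    finally show ?thesis .
  next
    case False
    have "b k \<le> 1 * b j" using mono[of k j] False that by simp
    also have "\<dots> \<le> K * b j" using K pos[of j] by (intro mult_right_mono) auto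
    finally show ?thesis .
  qed
  have "summable (\<lambda>n. 1 / b (Suc n))"
  proof (rule summable_comparison_test)
    have "sqrt (b (Suc n) * b n) \<le> K * b (Suc n)" for n
      using al[of n "Suc n"] pos[of "Suc n"] K by (intro sqrt_mult_le) auto
    then have "1 / b (Suc n) \<le> K * (1 / sqrt (b (Suc n) * b n))" for n
      using pos[of n] pos[of "Suc n"] by (simp add: field_simps)
    then show "\<exists>N. \<forall>n\<ge>N. norm (1 / b (Suc n)) \<le> K * (1 / sqrt (b (Suc n) * b n))"
      using pos by (simp add: less_imp_le)
  qed (intro summable_mult sum)
  then have "summable (\<lambda>n. 1 / b n)" by (subst (asm) summable_Suc_iff)
  with pos K al show ?thesis
    by (auto intro!: exI[of _ K] almost_increasing.intro)
qed

definition log_regular :: "(nat \<Rightarrow> real) \<Rightarrow> bool" where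
  "log_regular b \<longleftrightarrow> (\<exists>n0\<ge>1. (\<forall>n\<ge>n0. (b n)\<^sup>2 \<le> b (n - 1) * b (n + 1)) \<or>
                               (\<forall>n\<ge>n0. (b n)\<^sup>2 \<ge> b (n - 1) * b (n + 1)))"

text \<open>A sequence decreasing from some index on would keep the terms of the convergent series
  away from \<open>0\<close>. In the log-convex case one increase forces all later ones; in the
  log-concave case one decrease forces all later ones, so none can occur from \<open>n0\<close>
  on.\<close>

lemma log_regular_almost_increasing:
  fixes b :: "nat \<Rightarrow> real"
  assumes pos: "\<And>n. 0 < b n"
    and sum: "summable (\<lambda>n. 1 / sqrt (b (Suc n) * b n))"
    and reg: "log_regular b"
  shows "\<exists>K. almost_increasing b K"
proof -
  obtain n0 where n0: "n0 \<ge> 1" "(\<forall>n\<ge>n0. (b n)\<^sup>2 \<le> b (n - 1) * b (n + 1)) \<or>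
                               (\<forall>n\<ge>n0. (b n)\<^sup>2 \<ge> b (n - 1) * b (n + 1))"
    using reg unfolding log_regular_def by blast
  have unbounded: False if dec: "\<And>n. n \<ge> m \<Longrightarrow> b (Suc n) \<le> b n" for m
  proof -
    have le: "b n \<le> b m" if "n \<ge> m" for n
      using that
    proof (induction n rule: dec_induct)
      case (step n)
      with dec[of n] show ?case by simp
    qed simp
    have ge: "1 / b m \<le> 1 / sqrt (b (Suc n) * b n)" if "n \<ge> m" for n
    proof -
      have "b (Suc n) * b n \<le> (b m)\<^sup>2"
        unfolding power2_eq_square
        using le[OF that] le[of "Suc n"] that pos[of m] pos[of n] pos[of "Suc n"]
        by (intro mult_mono) auto
      then have "sqrt (b (Suc n) * b n) \<le> b m"
        using pos[of m] by (intro real_le_lsqrt) auto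
      then show ?thesis using pos[of m] pos[of n] pos[of "Suc n"] by (intro divide_left_mono) auto
    qed
    have "1 / b m \<le> 0"
      by (rule LIMSEQ_le_const[OF summable_LIMSEQ_zero[OF sum]]) (use ge in blast)
    then show False using pos[of m] by (simp add: field_simps)
  qed
  have "\<exists>m. \<forall>n\<ge>m. b n \<le> b (Suc n)"
    using n0(2)
  proof
    assume cvx: "\<forall>n\<ge>n0. (b n)\<^sup>2 \<le> b (n - 1) * b (n + 1)"
    obtain k where k: "k \<ge> n0" "b k \<le> b (Suc k)"
      using unbounded[of n0] by (metis linorder_le_cases)
    have "b n \<le> b (Suc n)" if "n \<ge> k" for n
      using that
    proof (induction n rule: dec_induct)
      case base show ?case by (rule k)
    next
      case (step n)
      have "b (Suc n) * b (Suc n) \<le> b n * b (Suc (Suc n))"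
        using cvx[rule_format, of "Suc n"] step k by (simp add: power2_eq_square)
      also have "\<dots> \<le> b (Suc n) * b (Suc (Suc n))"
        using step pos[of "Suc (Suc n)"] by (intro mult_right_mono) auto
      finally show ?case using pos[of "Suc n"] by simp
    qed
    then show ?thesis by blast
  next
    assume ccv: "\<forall>n\<ge>n0. (b n)\<^sup>2 \<ge> b (n - 1) * b (n + 1)"
    have "b k \<le> b (Suc k)" if k: "k \<ge> n0" for k
    proof (rule ccontr)
      assume *: "\<not> b k \<le> b (Suc k)"
      have "b (Suc n) \<le> b n" if "n \<ge> k" for n
        using that
      proof (induction n rule: dec_induct)
        case base show ?case using * by simp
      next
        case (step n)
        have "b n * b (Suc (Suc n)) \<le> b (Suc n) * b (Suc n)"
          using ccv[rule_format, of "Suc n"] step k by (simp add: power2_eq_square)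
        also have "\<dots> \<le> b n * b (Suc n)"
          using step pos[of "Suc n"] by (intro mult_right_mono) auto
        finally show ?case using pos[of n] by simp
      qed
      then show False by (rule unbounded)
    qed
    then show ?thesis by blast
  qed
  then show ?thesis
    using almost_increasing_if_eventually_incseq[OF pos _ sum] by blast
qed

text \<open>Weights for which \<open>d n * \<bar>P n\<bar>\<close> obeys a two-step recurrence with coefficient at most \<open>1\<close> on the
  older term: \<open>d n = sqrt (b (n - 1))\<close> in the log-convex, \<open>d n = sqrt (b n)\<close> in the log-concave case.\<close>

lemma log_regular_weights:
  fixes b :: "nat \<Rightarrow> real"
  assumes ai: "almost_increasing b K" and reg: "log_regular b"
  shows "\<exists>d m. (\<forall>n. 0 < d n) \<and> summable (\<lambda>n. 1 / (d n)\<^sup>2) \<and>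
    (\<forall>n\<ge>m. d (n+2) * b n \<le> b (n+1) * d n \<and> d (n+2) * sqrt (b (n+1) * b n) \<le> b (n+1) * d (n+1))"
proof -
  interpret almost_increasing b K by fact
  obtain n0 where n0: "n0 \<ge> 1" "(\<forall>n\<ge>n0. (b n)\<^sup>2 \<le> b (n - 1) * b (n + 1)) \<or>
                               (\<forall>n\<ge>n0. (b n)\<^sup>2 \<ge> b (n - 1) * b (n + 1))"
    using reg unfolding log_regular_def by blast
  from n0(2) show ?thesis
  proof
    assume cvx: "\<forall>n\<ge>n0. (b n)\<^sup>2 \<le> b (n - 1) * b (n + 1)"
    \<comment> \<open>For \<open>n = 0\<close> truncated subtraction gives the weight
      \<open>sqrt (b 0)\<close>; the inequalities are claimed only for
      \<open>n \<ge> n0 \<ge> 1\<close>, where \<open>n - 1\<close> is genuine.\<close>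
    have "summable (\<lambda>n. 1 / (sqrt (b (n - 1)))\<^sup>2)"
      using summable_inverse pos by (subst summable_Suc_iff[symmetric]) (simp add: less_imp_le)
    moreover have "sqrt (b (n+1)) * b n \<le> b (n+1) * sqrt (b (n-1))" if "n \<ge> n0" for n
    proof -
      have "sqrt (b (n+1)) * b n = sqrt (b (n+1) * (b n)\<^sup>2)"
        using pos[of n] by (simp add: real_sqrt_mult)
      also have "\<dots> \<le> sqrt (b (n+1) * (b (n - 1) * b (n + 1)))"
        using cvx that pos[of "n+1"] by (intro real_sqrt_le_mono mult_left_mono) auto
      also have "\<dots> = b (n+1) * sqrt (b (n-1))"
        using pos[of "n+1"] by (simp add: real_sqrt_mult)
      finally show ?thesis .
    qed
    moreover have "sqrt (b (n+1)) * sqrt (b (n+1) * b n) = b (n+1) * sqrt (b n)" for n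
      using pos[of "n+1"] by (simp add: real_sqrt_mult)
    ultimately show ?thesis
      using pos by (intro exI[of _ "\<lambda>n. sqrt (b (n - 1))"] exI[of _ n0]) auto
  next
    assume ccv: "\<forall>n\<ge>n0. (b n)\<^sup>2 \<ge> b (n - 1) * b (n + 1)"
    have "summable (\<lambda>n. 1 / (sqrt (b n))\<^sup>2)"
      using summable_inverse pos by (simp add: less_imp_le)
    moreover have "sqrt (b (n+2)) * b n \<le> b (n+1) * sqrt (b n)" 
       "sqrt (b (n+2)) * sqrt (b (n+1) * b n) \<le> b (n+1) * sqrt (b (n+1))" if "n \<ge> n0" for n
    proof -
      have "sqrt (b (n+2)) * sqrt (b n) = sqrt (b n * b (n + 2))"
        by (simp add: real_sqrt_mult)
      also have "\<dots> \<le> sqrt ((b (n+1))\<^sup>2)"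
        using ccv[rule_format, of "n+1"] that by (intro real_sqrt_le_mono) simp
      also have "\<dots> = b (n+1)" using pos[of "n+1"] by simp
      finally have *: "sqrt (b (n+2)) * sqrt (b n) \<le> b (n+1)" .
      have "sqrt (b (n+2)) * b n = (sqrt (b (n+2)) * sqrt (b n)) * sqrt (b n)"
        using pos[of n] by simp
      also have "\<dots> \<le> b (n+1) * sqrt (b n)"
        using * pos[of n] by (intro mult_right_mono) auto
      finally show "sqrt (b (n+2)) * b n \<le> b (n+1) * sqrt (b n)" .
      have "sqrt (b (n+2)) * sqrt (b (n+1) * b n) = (sqrt (b (n+2)) * sqrt (b n)) * sqrt (b (n+1))"
        by (simp add: real_sqrt_mult)
      also have "\<dots> \<le> b (n+1) * sqrt (b (n+1))"
        using * pos[of "n+1"] by (intro mult_right_mono) auto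
      finally show "sqrt (b (n+2)) * sqrt (b (n+1) * b n) \<le> b (n+1) * sqrt (b (n+1))" .
    qed
    ultimately show ?thesis
      using pos by (intro exI[of _ "\<lambda>n. sqrt (b n)"] exI[of _ n0]) auto
  qed
qed

section \<open>Power series with nonnegative coefficients\<close>

lemma max_modulus_upper:
  fixes f :: "complex \<Rightarrow> 'a::real_normed_vector"
  assumes "\<And>z. norm z \<le> r \<Longrightarrow> norm (f z) \<le> M" "norm z \<le> r"
  shows "norm (f z) \<le> max_modulus f r"
  unfolding max_modulus_def
  by (rule cSUP_upper) (use assms in \<open>auto intro!: bdd_aboveI[of _ M]\<close>)

lemma max_modulus_least:
  fixes f :: "complex \<Rightarrow> 'a::real_normed_vector"
  assumes "0 \<le> r" "\<And>z. norm z \<le> r \<Longrightarrow> norm (f z) \<le> M"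
  shows "max_modulus f r \<le> M"
  unfolding max_modulus_def by (rule cSUP_least) (use assms in auto)

lemma max_modulus_eq:
  fixes f :: "complex \<Rightarrow> complex"
  assumes "f (complex_of_real r) = of_real m" "\<And>z. norm z \<le> r \<Longrightarrow> norm (f z) \<le> m" "0 \<le> r" "0 \<le> m"
  shows "max_modulus f r = m"
  unfolding max_modulus_def
proof (rule cSup_eq_maximum)
  have "m = norm (f (of_real r))" using assms by simp
  then show "m \<in> (\<lambda>z. norm (f z)) ` cball 0 r"
    using assms(3) by (intro image_eqI[of _ _ "of_real r"]) auto
qed (use assms in auto)

text \<open>With nonnegative coefficients the triangle inequality is an equality at
  \<open>z = r\<close>, so the maximum sits there. The exponents \<open>e n\<close> cover the even
  powers in \<open>F_fun\<close>.\<close>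

lemma max_modulus_power_series:
  fixes c :: "nat \<Rightarrow> real" and e :: "nat \<Rightarrow> nat"
  assumes c: "\<And>n. 0 \<le> c n" and s: "summable (\<lambda>n. c n * r ^ e n)" and r: "0 \<le> r"
  shows "max_modulus (\<lambda>z. \<Sum>n. of_real (c n) * z ^ e n :: complex) r = (\<Sum>n. c n * r ^ e n)"
proof (rule max_modulus_eq)
  show "(\<Sum>n. of_real (c n) * complex_of_real r ^ e n) = of_real (\<Sum>n. c n * r ^ e n)"
    using suminf_of_real[OF s, where 'a = complex] by simp
  show "norm (\<Sum>n. of_real (c n) * z ^ e n) \<le> (\<Sum>n. c n * r ^ e n)" if "norm z \<le> r" for z :: complex
    using c that by (intro norm_suminf_le s) (auto simp: norm_mult norm_power intro!: mult_left_mono power_mono)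
qed (use c r in \<open>auto intro!: suminf_nonneg s\<close>)

definition entire_coeffs :: "(nat \<Rightarrow> real) \<Rightarrow> bool" where
  "entire_coeffs c \<longleftrightarrow> (\<forall>n. 0 \<le> c n) \<and> (\<forall>r\<ge>0. summable (\<lambda>n. c n * r ^ n))"

text \<open>A factor \<open>K ^ n\<close> in the coefficients is a dilation of the variable.\<close>

lemma entire_coeffs_scale_le:
  assumes c: "entire_coeffs c" and d: "\<And>n. 0 \<le> d n" and K: "0 \<le> K" and le: "\<And>n. d n \<le> K ^ n * c n"
  shows "entire_coeffs d"
    and "0 \<le> r \<Longrightarrow> (\<Sum>n. d n * r ^ n) \<le> (\<Sum>n. c n * (K * r) ^ n)"
proof -
  have *: "d n * r ^ n \<le> c n * (K * r) ^ n" if "0 \<le> r" for n r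
    using mult_right_mono[OF le[of n], of "r ^ n"] that by (simp add: power_mult_distrib algebra_simps)
  have sc: "summable (\<lambda>n. c n * (K * r) ^ n)" if "0 \<le> r" for r
    using c K that unfolding entire_coeffs_def by simp
  have sd: "summable (\<lambda>n. d n * r ^ n)" if "0 \<le> r" for r
    by (rule summable_comparison_test[OF _ sc[OF that]]) (use * d that in auto)
  show "entire_coeffs d"
    using d sd by (simp add: entire_coeffs_def)
  show "(\<Sum>n. d n * r ^ n) \<le> (\<Sum>n. c n * (K * r) ^ n)" if "0 \<le> r"
    by (intro suminf_le * sd sc that)
qed

text \<open>The terms at \<open>r\<close> are \<open>(1/2) ^ n\<close> times those at
  \<open>2 * r\<close>, so a bound for single terms bounds the whole series. The doubled radii in
  the comparisons come from here.\<close>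

lemma power_series_le_twice_bound:
  fixes c :: "nat \<Rightarrow> real"
  assumes c: "\<And>n. 0 \<le> c n" and r: "0 \<le> r" and le: "\<And>n. c n * (2 * r) ^ n \<le> B"
  shows "summable (\<lambda>n. c n * r ^ n)" and "(\<Sum>n. c n * r ^ n) \<le> 2 * B"
proof -
  have sB: "summable (\<lambda>n. B * (1/2::real) ^ n)"
    by (intro summable_mult summable_geometric) simp
  have termwise: "c n * r ^ n \<le> B * (1/2) ^ n" for n
    using le[of n] by (simp add: power_mult_distrib power_divide field_simps)
  show sc: "summable (\<lambda>n. c n * r ^ n)"
    by (rule summable_comparison_test[OF _ sB]) (use termwise c r in auto)
  have "(\<Sum>n. c n * r ^ n) \<le> (\<Sum>n. B * (1/2) ^ n)"
    by (rule suminf_le[OF termwise sc sB])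
  also have "\<dots> = 2 * B"
    by (simp add: suminf_mult suminf_geometric)
  finally show "(\<Sum>n. c n * r ^ n) \<le> 2 * B" .
qed

lemma power_series_ge_term:
  assumes c: "entire_coeffs c" and r: "0 \<le> r"
  shows "c n * r ^ n \<le> (\<Sum>n. c n * r ^ n)"
proof -
  have "sum (\<lambda>n. c n * r ^ n) {n} \<le> (\<Sum>n. c n * r ^ n)"
    using c r unfolding entire_coeffs_def by (intro sum_le_suminf) auto
  then show ?thesis by simp
qed

section \<open>Real polynomials at complex points\<close>

abbreviation cpoly :: "real poly \<Rightarrow> complex \<Rightarrow> complex" where
  "cpoly p z \<equiv> poly (map_poly complex_of_real p) z"

lemma cpoly_add: "cpoly (p + q) z = cpoly p z + cpoly q z"
proof -
  have "map_poly complex_of_real (p + q) = map_poly of_real p + map_poly of_real q"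
    by (rule poly_eqI) (simp add: coeff_map_poly)
  then show ?thesis by simp
qed

lemma cpoly_smult: "cpoly (smult c p) z = of_real c * cpoly p z"
  by (simp add: map_poly_smult)

lemma cpoly_pCons: "cpoly (pCons c p) z = of_real c + z * cpoly p z"
  by (simp add: map_poly_pCons)

lemma cpoly_mult: "cpoly (p * q) z = cpoly p z * cpoly q z"
proof -
  have "map_poly complex_of_real (p * q) = map_poly of_real p * map_poly of_real q"
    by (rule poly_eqI) (simp add: coeff_map_poly coeff_mult)
  then show ?thesis by simp
qed

lemma cpoly_of_real: "cpoly p (of_real x) = of_real (poly p x)"
  by (induction p) (simp_all add: map_poly_pCons)

lemma cpoly_bound: "\<exists>B\<ge>0. \<forall>z. norm (cpoly p z) \<le> B * (1 + norm z) ^ degree p"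
proof (intro exI[of _ "\<Sum>i\<le>degree p. \<bar>coeff p i\<bar>"] conjI allI)
  fix z
  have "norm (cpoly p z) \<le> (\<Sum>i\<le>degree p. norm (complex_of_real (coeff p i) * z ^ i))"
    by (simp add: poly_altdef coeff_map_poly degree_map_poly) (rule norm_sum)
  also have "\<dots> \<le> (\<Sum>i\<le>degree p. \<bar>coeff p i\<bar> * (1 + norm z) ^ degree p)"
  proof (rule sum_mono)
    fix i assume "i \<in> {..degree p}"
    have "norm z ^ i \<le> (1 + norm z) ^ i" by (intro power_mono) auto
    also have "\<dots> \<le> (1 + norm z) ^ degree p"
      using \<open>i \<in> _\<close> by (intro power_increasing) auto
    finally show "norm (complex_of_real (coeff p i) * z ^ i) \<le> \<bar>coeff p i\<bar> * (1 + norm z) ^ degree p"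
      by (simp add: norm_mult norm_power mult_left_mono)
  qed
  finally show "norm (cpoly p z) \<le> (\<Sum>i\<le>degree p. \<bar>coeff p i\<bar>) * (1 + norm z) ^ degree p"
    by (simp add: sum_distrib_right)
qed (simp add: sum_nonneg)

text \<open>The maximum principle for the reflected polynomial on the disc of radius \<open>1 / r\<close>.\<close>

lemma lead_coeff_le_max_modulus:
  fixes p :: "complex poly"
  assumes r: "0 < r" and le: "\<And>z. norm z = r \<Longrightarrow> norm (poly p z) \<le> M"
  shows "norm (lead_coeff p) * r ^ degree p \<le> M"
proof -
  have "norm (poly (reflect_poly p) 0) \<le> M / r ^ degree p"
  proof (rule maximum_modulus_frontier[of "poly (reflect_poly p)" "ball 0 (1/r)"])
    show "poly (reflect_poly p) holomorphic_on interior (ball 0 (1 / r))"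
      by (intro holomorphic_intros)
    show "continuous_on (closure (ball 0 (1 / r))) (poly (reflect_poly p))"
      by (intro continuous_intros)
    fix z :: complex assume "z \<in> frontier (ball 0 (1 / r))"
    then have z: "norm z = 1 / r" using r by (simp add: frontier_ball)
    then have "z \<noteq> 0" using r by auto
    then have "norm (poly (reflect_poly p) z) = norm (poly p (inverse z)) / r ^ degree p"
      using z by (simp add: poly_reflect_poly_nz norm_mult norm_power power_divide)
    also have "\<dots> \<le> M / r ^ degree p"
      using r z by (intro divide_right_mono le) (auto simp: norm_inverse)
    finally show "norm (poly (reflect_poly p) z) \<le> M / r ^ degree p" .
  qed (use r in auto)
  then show ?thesis using r by (simp add: field_simps)
qed

section \<open>Orthonormal polynomials\<close>

text \<open>A discrete Gronwall inequality for the maximum of two consecutive terms. The product may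
  start at \<open>0\<close> rather than \<open>m\<close> since its factors are at least
  \<open>1\<close>.\<close>

lemma two_step_recurrence_bound:
  fixes v e :: "nat \<Rightarrow> real"
  assumes v: "\<And>n. 0 \<le> v n" and e: "\<And>n. 0 \<le> e n"
    and rec: "\<And>n. n \<ge> m \<Longrightarrow> v (n + 2) \<le> e n * v (n + 1) + v n"
    and n: "n \<ge> m"
  shows "max (v n) (v (Suc n)) \<le> max (v m) (v (Suc m)) * (\<Prod>k<n. 1 + e k)"
  using n
proof (induction n rule: dec_induct)
  case base
  have "1 \<le> (\<Prod>k<m. 1 + e k)" by (rule prod_ge_1) (use e in auto)
  then show ?case using v[of m] by (simp add: mult_left_le mult_le_cancel_left1 le_max_iff_disj)
next
  case (step n)
  let ?M = "max (v n) (v (Suc n))"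
  have "v (Suc (Suc n)) \<le> e n * ?M + ?M"
    using rec[of n] step e[of n] mult_left_mono[of "v (Suc n)" ?M "e n"] by auto
  moreover have "v (Suc n) \<le> e n * ?M + ?M"
    using v[of n] e[of n] by (intro add_increasing mult_nonneg_nonneg) auto
  ultimately have "max (v (Suc n)) (v (Suc (Suc n))) \<le> ?M * (1 + e n)"
    by (simp add: algebra_simps)
  also have "\<dots> \<le> max (v m) (v (Suc m)) * (\<Prod>k<n. 1 + e k) * (1 + e n)"
    using step e[of n] by (intro mult_right_mono) auto
  finally show ?case by (simp add: algebra_simps)
qed

section \<open>The moment functional and expansions in orthonormal polynomials\<close>

definition moment_functional :: "real measure \<Rightarrow> real poly \<Rightarrow> real" where
  "moment_functional M p = (LINT x|M. poly p x)"

lemma has_moments_integrable_poly: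
  assumes "has_moments M s" shows "integrable M (poly p)"
proof -
  have "poly p = (\<lambda>x. \<Sum>i\<le>degree p. coeff p i * x ^ i)"
    by (rule ext) (rule poly_altdef)
  moreover have "integrable M (\<lambda>x. \<Sum>i\<le>degree p. coeff p i * x ^ i)"
    using assms unfolding has_moments_def by (intro Bochner_Integration.integrable_sum integrable_mult_right) auto
  ultimately show ?thesis by simp
qed

locale hamburger =
  fixes \<mu> :: "real measure" and s :: "nat \<Rightarrow> real"
    and P :: "nat \<Rightarrow> real poly" and a b :: "nat \<Rightarrow> real"
  assumes normalized: "normalized_Hamburger \<mu> s"
    and orthonormal: "orthonormal_polys \<mu> P"
    and recurrence: "recurrence_coeffs P a b"
begin

abbreviation \<Lambda> :: "real poly \<Rightarrow> real" where "\<Lambda> \<equiv> moment_functional \<mu>"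

lemma moments: "has_moments \<mu> s" and prob: "prob_space \<mu>"
  using normalized by (auto simp: normalized_Hamburger_def)

lemma integrable_poly [simp]: "integrable \<mu> (poly p)"
  by (rule has_moments_integrable_poly[OF moments])

lemma \<Lambda>_add: "\<Lambda> (p + q) = \<Lambda> p + \<Lambda> q"
  unfolding moment_functional_def poly_add by (rule Bochner_Integration.integral_add) auto

lemma \<Lambda>_smult: "\<Lambda> (smult c p) = c * \<Lambda> p"
proof -
  have "poly (smult c p) = (\<lambda>x. c * poly p x)" by (rule ext) simp
  then show ?thesis by (simp add: moment_functional_def)
qed

lemma \<Lambda>_0 [simp]: "\<Lambda> 0 = 0"
  using \<Lambda>_smult[of 0 0] by simp

lemma \<Lambda>_diff: "\<Lambda> (p - q) = \<Lambda> p - \<Lambda> q"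
  unfolding moment_functional_def poly_diff by (rule Bochner_Integration.integral_diff) auto

lemma \<Lambda>_sum: "\<Lambda> (\<Sum>i\<in>A. f i) = (\<Sum>i\<in>A. \<Lambda> (f i))"
  by (induction A rule: infinite_finite_induct) (auto simp: \<Lambda>_add)

lemma \<Lambda>_monom: "\<Lambda> (monom 1 n) = s n"
  using moments by (simp add: moment_functional_def poly_monom has_moments_def)

lemma s_0: "s 0 = 1"
  using moments prob_space.prob_space[OF prob] by (simp add: has_moments_def)

lemma \<Lambda>_ortho: "\<Lambda> (P m * P n) = (if m = n then 1 else 0)"
  using orthonormal by (simp add: moment_functional_def orthonormal_polys_def)

lemma degree_P [simp]: "degree (P n) = n" and lead_P: "0 < coeff (P n) n"
  using orthonormal unfolding orthonormal_polys_def by metis+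

lemma P_0: "P 0 = 1"
  by (rule orthonormal_polys_0[OF normalized orthonormal])

lemma b_pos: "0 < b n"
  using recurrence by (simp add: recurrence_coeffs_def)

lemma coeff_P: "coeff (P n) n = 1 / (\<Prod>k<n. b k)"
  using lead_coeff_orthonormal_polys[OF normalized orthonormal recurrence, of n] by simp

lemma x_times_P:
  "pCons 0 (P n) = smult (b n) (P (Suc n)) + smult (a n) (P n) +
     (if n = 0 then 0 else smult (b (n - 1)) (P (n - 1)))"
proof -
  have "[:0, 1:] * P n = smult (b n) (P (Suc n)) + smult (a n) (P n) +
     (if n = 0 then 0 else smult (b (n - 1)) (P (n - 1)))"
    using recurrence unfolding recurrence_coeffs_def by blast
  then show ?thesis by simp
qed

lemma ex_P_expansion: "degree p \<le> n \<Longrightarrow> \<exists>c. p = (\<Sum>k\<le>n. smult (c k) (P k))"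
proof (induction n arbitrary: p)
  case 0
  then obtain d where "p = [:d:]" by (metis degree_eq_zeroE le_zero_eq)
  then show ?case by (intro exI[of _ "\<lambda>_. d"]) (simp add: P_0)
next
  case (Suc n)
  define d where "d = coeff p (Suc n) / coeff (P (Suc n)) (Suc n)"
  have "degree (p - smult d (P (Suc n))) \<le> n"
  proof (rule degree_le, intro allI impI)
    fix i assume "n < i"
    show "coeff (p - smult d (P (Suc n))) i = 0"
    proof (cases "i = Suc n")
      case True
      then show ?thesis using lead_P[of "Suc n"] by (simp add: d_def)
    next
      case False
      then show ?thesis using Suc.prems \<open>n < i\<close> by (simp add: coeff_eq_0)
    qed
  qed
  then obtain c where c: "p - smult d (P (Suc n)) = (\<Sum>k\<le>n. smult (c k) (P k))"
    using Suc.IH by blast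
  have "p = (p - smult d (P (Suc n))) + smult d (P (Suc n))" by simp
  also have "\<dots> = (\<Sum>k\<le>n. smult (c k) (P k)) + smult d (P (Suc n))"
    by (simp only: c)
  also have "\<dots> = (\<Sum>k\<le>Suc n. smult ((c(Suc n := d)) k) (P k))"
    by (simp add: sum.atMost_Suc)
  finally show ?case by blast
qed

lemma P_expansion:
  assumes "degree p \<le> n"
  shows "p = (\<Sum>k\<le>n. smult (\<Lambda> (p * P k)) (P k))"
proof -
  obtain c where c: "p = (\<Sum>k\<le>n. smult (c k) (P k))"
    using ex_P_expansion[OF assms] by blast
  have "\<Lambda> (p * P j) = (if j \<le> n then c j else 0)" for j
    by (simp add: c sum_distrib_right \<Lambda>_sum \<Lambda>_smult \<Lambda>_ortho if_distrib sum.delta cong: if_cong)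
  then show ?thesis
    using c by (metis (mono_tags, lifting) atMost_iff sum.cong)
qed

lemma parseval:
  assumes "degree p \<le> n"
  shows "\<Lambda> (p * p) = (\<Sum>k\<le>n. (\<Lambda> (p * P k))\<^sup>2)"
proof -
  have "\<Lambda> (p * p) = \<Lambda> (p * (\<Sum>k\<le>n. smult (\<Lambda> (p * P k)) (P k)))"
    using P_expansion[OF assms] by simp
  also have "\<dots> = (\<Sum>k\<le>n. (\<Lambda> (p * P k))\<^sup>2)"
    by (simp add: sum_distrib_left \<Lambda>_sum \<Lambda>_smult power2_eq_square)
  finally show ?thesis .
qed

text \<open>Positivity is read off the expansion: by Parseval, a zero value makes all coefficients
  of \<open>p\<close> along the \<open>P k\<close> vanish.\<close>

lemma \<Lambda>_square_pos:
  assumes "p \<noteq> 0" shows "0 < \<Lambda> (p * p)"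
proof (rule ccontr)
  assume "\<not> ?thesis"
  then have "\<Lambda> (p * p) = 0"
    using parseval[of p "degree p"] by (simp add: sum_nonneg antisym)
  then have "\<forall>k\<le>degree p. \<Lambda> (p * P k) = 0"
    using parseval[of p "degree p"] by (simp add: sum_nonneg_eq_0_iff)
  then have "p = 0"
    using P_expansion[of p "degree p"] by simp
  with assms show False by simp
qed

lemma \<Lambda>_lower_degree:
  assumes "degree p < n" shows "\<Lambda> (p * P n) = 0"
proof -
  define m where "m = degree p"
  have "m < n" using assms by (simp add: m_def)
  obtain c where c: "p = (\<Sum>k\<le>m. smult (c k) (P k))"
    using ex_P_expansion[of p m] m_def by blast
  have "\<Lambda> (p * P n) = (\<Sum>k\<le>m. c k * \<Lambda> (P k * P n))"
    unfolding c by (simp add: sum_distrib_right \<Lambda>_sum \<Lambda>_smult)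
  also have "\<dots> = 0" using \<open>m < n\<close> by (simp add: \<Lambda>_ortho)
  finally show ?thesis .
qed

section \<open>Powers of x and the Jacobi matrix\<close>

definition xcoef :: "nat \<Rightarrow> nat \<Rightarrow> real" where
  "xcoef n k = \<Lambda> (monom 1 n * P k)"

text \<open>This is the action of the symmetric Jacobi matrix: \<open>xcoef n k\<close> is the entry
  in row \<open>0\<close> and column \<open>k\<close> of its n-th power.\<close>

lemma xcoef_Suc:
  "xcoef (Suc n) k = b k * xcoef n (Suc k) + a k * xcoef n k + (if k = 0 then 0 else b (k - 1) * xcoef n (k - 1))"
proof -
  have "monom 1 (Suc n) * P k = monom 1 n * pCons 0 (P k)"
    by (simp add: monom_Suc)
  then show ?thesis
    unfolding xcoef_def x_times_P by (simp add: distrib_left \<Lambda>_add \<Lambda>_smult)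
qed

lemma xcoef_eq_0: "n < k \<Longrightarrow> xcoef n k = 0"
  unfolding xcoef_def by (rule \<Lambda>_lower_degree) (simp add: degree_monom_eq)

lemma xcoef_diag: "xcoef n n = (\<Prod>k<n. b k)"
proof (induction n)
  case 0
  then show ?case using \<Lambda>_ortho[of 0 0] by (simp add: xcoef_def P_0 monom_0 one_pCons)
next
  case (Suc n)
  then show ?case by (simp add: xcoef_Suc xcoef_eq_0)
qed

lemma even_moment: "s (2 * n) = (\<Sum>k\<le>n. (xcoef n k)\<^sup>2)"
proof -
  have "s (2 * n) = \<Lambda> (monom 1 n * monom 1 n)"
    by (simp add: mult_monom \<Lambda>_monom[symmetric] mult_2)
  also have "\<dots> = (\<Sum>k\<le>n. (xcoef n k)\<^sup>2)"
    unfolding xcoef_def by (rule parseval) (simp add: degree_monom_eq)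
  finally show ?thesis .
qed

lemma prod_b_le_sqrt_moment: "(\<Prod>k<n. b k) \<le> sqrt (s (2 * n))"
proof (rule real_le_rsqrt)
  have "(\<Prod>k<n. b k)\<^sup>2 = sum (\<lambda>k. (xcoef n k)\<^sup>2) {n}" by (simp add: xcoef_diag)
  also have "\<dots> \<le> s (2 * n)"
    unfolding even_moment by (rule sum_mono2) auto
  finally show "(\<Prod>k<n. b k)\<^sup>2 \<le> s (2 * n)" .
qed

lemma prod_b_pos: "0 < (\<Prod>k<n. b k)"
  by (rule prod_pos) (simp add: b_pos)

lemma even_moment_pos: "0 < s (2 * n)"
  using prod_b_le_sqrt_moment[of n] prod_b_pos[of n] by (metis not_le order.strict_trans1 real_sqrt_le_0_iff)

text \<open>The coefficients of \<open>x ^ n\<close> live on \<open>{..n}\<close>, so one Jacobi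
  step uses only entries bounded by \<open>K * b n\<close>, and each coefficient feeds at most three
  new ones. Hence the sum of absolute values grows by a factor at most \<open>3 * K * b n\<close>.
  It dominates the Euclidean norm, which is \<open>sqrt (s (2 * n))\<close> by Parseval.\<close>

lemma sqrt_moment_le:
  assumes K: "0 \<le> K" and bK: "\<And>k j. k \<le> j \<Longrightarrow> b k \<le> K * b j" and aK: "\<And>k j. k \<le> j \<Longrightarrow> \<bar>a k\<bar> \<le> K * b j"
  shows "sqrt (s (2 * n)) \<le> (3 * K) ^ n * (\<Prod>k<n. b k)"
proof -
  have "(\<Sum>k\<le>n. \<bar>xcoef n k\<bar>) \<le> (3 * K) ^ n * (\<Prod>k<n. b k)"
  proof (induction n)
    case 0
    then show ?case using xcoef_diag[of 0] by simp
  next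
    case (Suc n)
    define S where "S = (\<Sum>k\<le>n. \<bar>xcoef n k\<bar>)"
    define B where "B = K * b n"
    have B: "0 \<le> B" using K b_pos[of n] by (simp add: B_def)
    have t1: "\<bar>b k * xcoef n (Suc k)\<bar> \<le> B * \<bar>xcoef n (Suc k)\<bar>" for k
      using bK[of k n] b_pos[of k] by (cases "k \<le> n") (auto simp: abs_mult xcoef_eq_0 B_def intro!: mult_right_mono)
    have t2: "\<bar>a k * xcoef n k\<bar> \<le> B * \<bar>xcoef n k\<bar>" for k
      using aK[of k n] by (cases "k \<le> n") (auto simp: abs_mult xcoef_eq_0 B_def intro!: mult_right_mono)
    have t3: "\<bar>if k = 0 then 0 else b (k - 1) * xcoef n (k - 1)\<bar> \<le> B * (if k = 0 then 0 else \<bar>xcoef n (k - 1)\<bar>)" for k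
      using bK[of "k - 1" n] b_pos[of "k - 1"]
      by (cases "k - 1 \<le> n") (auto simp: abs_mult xcoef_eq_0 B_def intro!: mult_right_mono)
    have "(\<Sum>k\<le>Suc n. \<bar>xcoef (Suc n) k\<bar>) \<le> (\<Sum>k\<le>Suc n. B * \<bar>xcoef n (Suc k)\<bar> + B * \<bar>xcoef n k\<bar> +
        B * (if k = 0 then 0 else \<bar>xcoef n (k - 1)\<bar>))"
    proof (rule sum_mono)
      fix k
      show "\<bar>xcoef (Suc n) k\<bar> \<le> B * \<bar>xcoef n (Suc k)\<bar> + B * \<bar>xcoef n k\<bar> +
        B * (if k = 0 then 0 else \<bar>xcoef n (k - 1)\<bar>)"
        unfolding xcoef_Suc using t1[of k] t2[of k] t3[of k] by linarith
    qed
    also have "\<dots> = B * ((\<Sum>k\<le>Suc n. \<bar>xcoef n (Suc k)\<bar>) + (\<Sum>k\<le>Suc n. \<bar>xcoef n k\<bar>) +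
        (\<Sum>k\<le>Suc n. (if k = 0 then 0 else \<bar>xcoef n (k - 1)\<bar>)))"
      by (simp only: sum.distrib sum_distrib_left[symmetric] distrib_left)
    also have "\<dots> \<le> B * (S + S + S)"
    proof (intro mult_left_mono add_mono B)
      have "(\<Sum>k\<le>Suc n. \<bar>xcoef n (Suc k)\<bar>) \<le> \<bar>xcoef n 0\<bar> + (\<Sum>k\<le>Suc n. \<bar>xcoef n (Suc k)\<bar>)" by simp
      also have "\<dots> = (\<Sum>k\<le>Suc (Suc n). \<bar>xcoef n k\<bar>)" by (rule sum.atMost_Suc_shift[symmetric])
      also have "\<dots> = S" by (simp add: S_def xcoef_eq_0)
      finally show "(\<Sum>k\<le>Suc n. \<bar>xcoef n (Suc k)\<bar>) \<le> S" .
      show "(\<Sum>k\<le>Suc n. \<bar>xcoef n k\<bar>) \<le> S" by (simp add: S_def xcoef_eq_0)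
      show "(\<Sum>k\<le>Suc n. (if k = 0 then 0 else \<bar>xcoef n (k - 1)\<bar>)) \<le> S"
        by (subst sum.atMost_Suc_shift) (simp add: S_def)
    qed
    also have "\<dots> = 3 * B * S" by simp
    also have "\<dots> \<le> 3 * B * ((3 * K) ^ n * (\<Prod>k<n. b k))"
      using Suc B by (intro mult_left_mono) (auto simp: S_def)
    also have "\<dots> = (3 * K) ^ Suc n * (\<Prod>k<Suc n. b k)"
      by (simp add: B_def)
    finally show ?case .
  qed
  moreover have "sqrt (s (2 * n)) \<le> (\<Sum>k\<le>n. \<bar>xcoef n k\<bar>)"
    unfolding even_moment using L2_set_le_sum_abs[of "xcoef n" "{..n}"]
    by (simp add: L2_set_def)
  ultimately show ?thesis by linarith
qed

end

section \<open>Growth of the orthonormal polynomials\<close>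

locale regular_hamburger = hamburger +
  fixes K :: real
  assumes almost_inc: "almost_increasing b K"
    and regular: "log_regular b"
    and summable_coeffs: "summable (\<lambda>n. (1 + \<bar>a (Suc n)\<bar>) / sqrt (b (Suc n) * b n))"
begin

sublocale almost_increasing b K by (rule almost_inc)

lemma sqrt_bb_pos: "0 < sqrt (b (Suc n) * b n)"
  using b_pos by simp

lemma sqrt_bb_le: "sqrt (b (Suc n) * b n) \<le> K * b (Suc n)"
  using mono[of n "Suc n"] b_pos[of "Suc n"] K by (intro sqrt_mult_le) auto

lemma le_sqrt_bb: "b n / K \<le> sqrt (b (Suc n) * b n)"
proof (rule real_le_rsqrt)
  have "(b n / K)\<^sup>2 = b n / K * b n / K" by (simp add: power2_eq_square)
  also have "\<dots> \<le> b n / K * b n"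
    using K b_pos[of n] by (simp add: divide_le_eq mult_le_cancel_left1)
  also have "\<dots> \<le> b (Suc n) * b n"
    using K mono[of n "Suc n"] b_pos[of n] by (intro mult_right_mono) (auto simp: field_simps)
  finally show "(b n / K)\<^sup>2 \<le> b (Suc n) * b n" .
qed

lemma summable_a: "summable (\<lambda>n. \<bar>a (Suc n)\<bar> / sqrt (b (Suc n) * b n))"
  by (rule summable_comparison_test[OF _ summable_coeffs])
     (use sqrt_bb_pos b_pos in \<open>auto simp: less_imp_le intro!: divide_right_mono\<close>)

lemma a_bounded: "\<exists>D\<ge>0. \<forall>n. \<bar>a n\<bar> \<le> D * b n"
proof -
  define S where "S = (\<Sum>n. \<bar>a (Suc n)\<bar> / sqrt (b (Suc n) * b n))"
  have nn: "0 \<le> \<bar>a (Suc n)\<bar> / sqrt (b (Suc n) * b n)" for n using b_pos by (simp add: less_imp_le)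
  have S: "0 \<le> S" unfolding S_def by (intro suminf_nonneg summable_a nn)
  \<comment> \<open>The series starts with \<open>a 1\<close>, so \<open>a 0\<close> contributes its
    own term; every other coefficient is controlled because a term of the series is at most its sum
    \<open>S\<close>.\<close>
  define D where "D = S * K + \<bar>a 0\<bar> / b 0"
  have "\<bar>a n\<bar> \<le> D * b n" for n
  proof (cases n)
    case 0
    then show ?thesis using S K b_pos[of 0] by (simp add: D_def field_simps)
  next
    case (Suc k)
    have "sum (\<lambda>n. \<bar>a (Suc n)\<bar> / sqrt (b (Suc n) * b n)) {k} \<le> S"
      unfolding S_def using nn by (intro sum_le_suminf summable_a) auto
    then have "\<bar>a (Suc k)\<bar> \<le> S * sqrt (b (Suc k) * b k)"
      using sqrt_bb_pos[of k] b_pos[of k] b_pos[of "Suc k"] by (simp add: field_simps)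
    also have "\<dots> \<le> S * (K * b (Suc k))"
      using S sqrt_bb_le by (intro mult_left_mono)
    also have "\<dots> \<le> D * b (Suc k)"
      using b_pos[of 0] b_pos[of "Suc k"] by (simp add: D_def algebra_simps)
    finally show ?thesis by (simp add: Suc)
  qed
  moreover have "0 \<le> D" using S K b_pos[of 0] by (simp add: D_def)
  ultimately show ?thesis by blast
qed

lemma cpoly_recurrence:
  "z * cpoly (P (Suc n)) z = of_real (b (Suc n)) * cpoly (P (n + 2)) z +
     of_real (a (Suc n)) * cpoly (P (Suc n)) z + of_real (b n) * cpoly (P n) z"
  using arg_cong[OF x_times_P[of "Suc n"], of "\<lambda>p. cpoly p z"]
  by (simp add: cpoly_add cpoly_smult cpoly_pCons)

text \<open>With the weights \<open>d\<close>, the sequence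
  \<open>v n = d n * norm (cpoly (P n) z)\<close> satisfies a two-step inequality with \<open>e n =
  (norm z + \<bar>a (Suc n)\<bar>) / sqrt (b (Suc n) * b n)\<close>. Factoring
  \<open>1 + e n\<close> separates a product that involves only \<open>a\<close> and
  \<open>b\<close>, bounded by \<open>exp S\<close> for all \<open>z\<close>, from the product of
  \<open>1 + K * norm z / b n\<close>. Dividing by \<open>d n\<close> leaves a square-summable
  weight.\<close>

lemma P_bound:
  "\<exists>C>0. \<exists>k w. summable (\<lambda>n. (w n)\<^sup>2) \<and> (\<forall>n. 0 \<le> w n) \<and>
     (\<forall>n z. norm (cpoly (P n) z) \<le> C * (1 + norm z) ^ k * exp (log_product (K * norm z)) * w n)"
proof -
  obtain d m where d: "\<And>n. 0 < d n" "summable (\<lambda>n. 1 / (d n)\<^sup>2)"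
    "\<And>n. n \<ge> m \<Longrightarrow> d (n+2) * b n \<le> b (n+1) * d n"
    "\<And>n. n \<ge> m \<Longrightarrow> d (n+2) * sqrt (b (n+1) * b n) \<le> b (n+1) * d (n+1)"
    using log_regular_weights[OF almost_inc regular] by blast
  have "\<forall>n. \<exists>B\<ge>0. \<forall>z. norm (cpoly (P n) z) \<le> B * (1 + norm z) ^ n"
    using cpoly_bound[of "P n" for n] by simp
  then obtain B where B: "\<And>n. 0 \<le> B n" "\<And>n z. norm (cpoly (P n) z) \<le> B n * (1 + norm z) ^ n"
    by metis
  define S where "S = (\<Sum>n. \<bar>a (Suc n)\<bar> / sqrt (b (Suc n) * b n))"
  have nn: "0 \<le> \<bar>a (Suc n)\<bar> / sqrt (b (Suc n) * b n)" for n using b_pos by (simp add: less_imp_le)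
  have S0: "0 \<le> S" unfolding S_def by (intro suminf_nonneg summable_a nn)
  \<comment> \<open>The factor \<open>1 + d n\<close> exceeds both \<open>1\<close> and
    \<open>d n\<close>: the same \<open>A\<close> serves the unweighted \<open>P n\<close> for
    \<open>n < m\<close> and the weighted starting values \<open>v m\<close> and
    \<open>v (Suc m)\<close>.\<close>
  define A where "A = (\<Sum>n\<le>Suc m. B n * (1 + d n))"
  have A0: "0 \<le> A" unfolding A_def using B d by (intro sum_nonneg) (simp add: add_nonneg_nonneg less_imp_le)
  have A: "B n * (1 + d n) \<le> A" if "n \<le> Suc m" for n
    unfolding A_def using B d that
    by (intro member_le_sum) (auto simp: add_nonneg_nonneg less_imp_le)
  have small: "(1 + d n) * norm (cpoly (P n) z) \<le> A * (1 + norm z) ^ Suc m" if "n \<le> Suc m" for n z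
  proof -
    have "(1 + d n) * norm (cpoly (P n) z) \<le> (1 + d n) * (B n * (1 + norm z) ^ n)"
      using B(2)[of n z] d(1)[of n] by (intro mult_left_mono) auto
    also have "\<dots> = B n * (1 + d n) * (1 + norm z) ^ n" by simp
    also have "\<dots> \<le> A * (1 + norm z) ^ Suc m"
      using A[OF that] A0 that by (intro mult_mono power_increasing) auto
    finally show ?thesis .
  qed
  \<comment> \<open>The two-step inequality starts only at \<open>m\<close>; the finitely many
    values \<open>1\<close> before it do not affect summability.\<close>
  define w where "w n = (if n < m then 1 else 1 / d n)" for n
  have w: "summable (\<lambda>n. (w n)\<^sup>2)"
    by (rule summable_comparison_test_ev[OF _ d(2)])
       (use eventually_ge_at_top[of m] in eventually_elim, simp add: w_def power_divide)
  have w0: "0 \<le> w n" for n using d(1)[of n] by (simp add: w_def)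
  have bound: "norm (cpoly (P n) z) \<le> (A + 1) * exp S * (1 + norm z) ^ Suc m * exp (log_product (K * norm z)) * w n" for n z
  proof -
    define r where "r = norm z"
    have r: "0 \<le> r" by (simp add: r_def)
    have W0: "0 \<le> log_product (K * r)" using r K by (intro log_product_nonneg) auto
    have E: "1 \<le> exp S * exp (log_product (K * r))"
      using S0 W0 by (simp add: exp_add[symmetric])
    have Ar: "A * (1 + r) ^ Suc m \<le> (A + 1) * (1 + r) ^ Suc m"
      using r by (intro mult_right_mono) auto
    define v where "v n = d n * norm (cpoly (P n) z)" for n
    have v0: "0 \<le> v n" for n using d(1)[of n] by (simp add: v_def)
    show ?thesis
    proof (cases "n < m")
      case True
      have "norm (cpoly (P n) z) \<le> (1 + d n) * norm (cpoly (P n) z)"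
        using d(1)[of n] by (simp add: mult_le_cancel_right1)
      also have "\<dots> \<le> A * (1 + r) ^ Suc m" using small[of n z] True by (simp add: r_def)
      also have "\<dots> \<le> (A + 1) * (1 + r) ^ Suc m" by (rule Ar)
      also have "\<dots> \<le> (A + 1) * (1 + r) ^ Suc m * (exp S * exp (log_product (K * r)))"
        using E A0 r mult_left_mono[OF E, of "(A + 1) * (1 + r) ^ Suc m"] by simp
      finally show ?thesis using True by (simp add: w_def r_def mult_ac)
    next
      case False
      define e where "e n = (r + \<bar>a (Suc n)\<bar>) / sqrt (b (Suc n) * b n)" for n
      have e0: "0 \<le> e n" for n using r b_pos by (simp add: e_def less_imp_le)
      have rec: "v (n + 2) \<le> e n * v (n + 1) + v n" if n: "n \<ge> m" for n
      proof -
        have "of_real (b (Suc n)) * cpoly (P (n + 2)) z =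
            (z - of_real (a (Suc n))) * cpoly (P (Suc n)) z - of_real (b n) * cpoly (P n) z"
          using cpoly_recurrence[of z n] by (simp add: algebra_simps)
        then have "b (Suc n) * norm (cpoly (P (n + 2)) z) =
            norm ((z - of_real (a (Suc n))) * cpoly (P (Suc n)) z - of_real (b n) * cpoly (P n) z)"
          using b_pos[of "Suc n"] by (metis abs_of_pos norm_mult norm_of_real)
        also have "\<dots> \<le> norm ((z - of_real (a (Suc n))) * cpoly (P (Suc n)) z) + norm (of_real (b n) * cpoly (P n) z)"
          by (rule norm_triangle_ineq4)
        also have "\<dots> \<le> (r + \<bar>a (Suc n)\<bar>) * norm (cpoly (P (Suc n)) z) + b n * norm (cpoly (P n) z)"
        proof -
          have "norm (z - of_real (a (Suc n))) \<le> r + \<bar>a (Suc n)\<bar>"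
            using norm_triangle_ineq4[of z "of_real (a (Suc n))"] by (simp add: r_def)
          then show ?thesis
            using b_pos[of n] by (simp add: norm_mult mult_right_mono)
        qed
        finally have 1: "b (Suc n) * norm (cpoly (P (n + 2)) z) \<le>
           (r + \<bar>a (Suc n)\<bar>) * norm (cpoly (P (Suc n)) z) + b n * norm (cpoly (P n) z)" .
        have "b (Suc n) * v (n + 2) = d (n + 2) * (b (Suc n) * norm (cpoly (P (n + 2)) z))"
          by (simp add: v_def)
        also have "\<dots> \<le> d (n + 2) * ((r + \<bar>a (Suc n)\<bar>) * norm (cpoly (P (Suc n)) z) + b n * norm (cpoly (P n) z))"
          using d(1)[of "n + 2"] by (intro mult_left_mono 1) auto
        also have "\<dots> = d (n + 2) * (r + \<bar>a (Suc n)\<bar>) * norm (cpoly (P (Suc n)) z) + d (n+2) * b n * norm (cpoly (P n) z)"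
          by (simp add: algebra_simps)
        also have "\<dots> \<le> b (Suc n) * d (n+1) * e n * norm (cpoly (P (Suc n)) z) + b (Suc n) * d n * norm (cpoly (P n) z)"
        proof (intro add_mono mult_right_mono)
          show "d (n + 2) * b n \<le> b (Suc n) * d n" using d(3)[OF n] by simp
          have "d (n + 2) * (r + \<bar>a (Suc n)\<bar>) = d (n + 2) * sqrt (b (Suc n) * b n) * e n"
            using sqrt_bb_pos[of n] b_pos[of n] b_pos[of "Suc n"] by (simp add: e_def)
          also have "\<dots> \<le> b (Suc n) * d (n+1) * e n"
            using d(4)[OF n] e0[of n] by (intro mult_right_mono) auto
          finally show "d (n + 2) * (r + \<bar>a (Suc n)\<bar>) \<le> b (Suc n) * d (n+1) * e n" .
        qed auto
        also have "\<dots> = b (Suc n) * (e n * v (n + 1) + v n)"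
          by (simp add: v_def algebra_simps)
        finally show ?thesis using b_pos[of "Suc n"] by simp
      qed
      have "v n \<le> max (v m) (v (Suc m)) * (\<Prod>k<n. 1 + e k)"
        using two_step_recurrence_bound[of v e m n, OF v0 e0 rec] False by simp
      also have "\<dots> \<le> (A + 1) * (1 + r) ^ Suc m * (exp S * exp (log_product (K * r)))"
      proof (rule mult_mono)
        have "v i \<le> A * (1 + r) ^ Suc m" if "i \<le> Suc m" for i
        proof -
          have "v i \<le> (1 + d i) * norm (cpoly (P i) z)"
            using d(1)[of i] by (simp add: v_def algebra_simps)
          also have "\<dots> \<le> A * (1 + r) ^ Suc m" using small[OF that] by (simp add: r_def)
          finally show ?thesis .
        qed
        then show "max (v m) (v (Suc m)) \<le> (A + 1) * (1 + r) ^ Suc m"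
          using Ar by (meson le_SucI max.boundedI order_refl order_trans)
        have "(\<Prod>k<n. 1 + e k) \<le> (\<Prod>k<n. exp (\<bar>a (Suc k)\<bar> / sqrt (b (Suc k) * b k)) * exp (ln (1 + K * r / b k)))"
        proof (rule prod_mono, safe)
          fix k
          show "0 \<le> 1 + e k" using e0[of k] by simp
          define c where "c = sqrt (b (Suc k) * b k)"
          have c: "0 < c" "b k / K \<le> c" unfolding c_def by (rule sqrt_bb_pos, rule le_sqrt_bb)
          have "r / c \<le> r / (b k / K)"
            using c r K b_pos[of k] by (intro divide_left_mono) auto
          then have rc: "r / c \<le> K * r / b k" by (simp add: mult.commute)
          have "1 + e k \<le> (1 + \<bar>a (Suc k)\<bar> / c) * (1 + r / c)"
            using c(1) r unfolding e_def c_def[symmetric] by (simp add: field_simps)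
          also have "\<dots> \<le> exp (\<bar>a (Suc k)\<bar> / c) * (1 + K * r / b k)"
            using rc c r by (intro mult_mono) (auto simp: exp_ge_add_one_self)
          also have "1 + K * r / b k = exp (ln (1 + K * r / b k))"
            using r K b_pos[of k] by (subst exp_ln) (auto intro!: add_pos_nonneg divide_nonneg_pos mult_nonneg_nonneg)
          finally show "1 + e k \<le> exp (\<bar>a (Suc k)\<bar> / sqrt (b (Suc k) * b k)) * exp (ln (1 + K * r / b k))"
            by (simp add: c_def)
        qed
        also have "\<dots> = exp (\<Sum>k<n. \<bar>a (Suc k)\<bar> / sqrt (b (Suc k) * b k)) * exp (\<Sum>k<n. ln (1 + K * r / b k))"
          by (simp only: prod.distrib exp_sum[OF finite_lessThan])
        also have "\<dots> \<le> exp S * exp (log_product (K * r))"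
        proof (intro mult_mono)
          show "exp (\<Sum>k<n. \<bar>a (Suc k)\<bar> / sqrt (b (Suc k) * b k)) \<le> exp S"
            unfolding exp_le_cancel_iff S_def using nn by (intro sum_le_suminf summable_a) auto
          show "exp (\<Sum>k<n. ln (1 + K * r / b k)) \<le> exp (log_product (K * r))"
            unfolding exp_le_cancel_iff log_product_def using r K b_pos
            by (intro sum_le_suminf summable_log_product) (auto simp: less_imp_le)
        qed auto
        finally show "(\<Prod>k<n. 1 + e k) \<le> exp S * exp (log_product (K * r))" .
        show "0 \<le> (\<Prod>k<n. 1 + e k)" using e0 by (intro prod_nonneg) (simp add: add_nonneg_nonneg)
      qed (use A0 r in auto)
      finally have "v n \<le> (A + 1) * (1 + r) ^ Suc m * (exp S * exp (log_product (K * r)))" .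
      then have "norm (cpoly (P n) z) \<le> (A + 1) * (1 + r) ^ Suc m * (exp S * exp (log_product (K * r))) / d n"
        using d(1)[of n] by (simp add: v_def field_simps)
      then show ?thesis using False by (simp add: w_def r_def mult_ac)
    qed
  qed
  show ?thesis
    by (rule exI[of _ "(A + 1) * exp S"], intro conjI exI[of _ "Suc m"] exI[of _ w] allI)
       (use A0 w w0 bound in auto)
qed

end

section \<open>Comparison of the growth orders\<close>

context regular_hamburger
begin

lemma P_fun_bound:
  "\<exists>C>0. \<exists>k. \<forall>z. summable (\<lambda>n. (cmod (cpoly (P n) z))\<^sup>2) \<and>
     P_fun P z \<le> C * (1 + norm z) ^ k * exp (log_product (K * norm z))"
proof -
  obtain C k w where C: "0 < C" and w: "summable (\<lambda>n. (w n)\<^sup>2)" and w0: "\<And>n. 0 \<le> w n"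
    and le: "\<And>n z. norm (cpoly (P n) z) \<le> C * (1 + norm z) ^ k * exp (log_product (K * norm z)) * w n"
    using P_bound by blast
  define S where "S = (\<Sum>n. (w n)\<^sup>2)"
  have S0: "0 \<le> S" unfolding S_def by (intro suminf_nonneg w) simp
  have "summable (\<lambda>n. (cmod (cpoly (P n) z))\<^sup>2) \<and>
     P_fun P z \<le> C * (sqrt S + 1) * (1 + norm z) ^ k * exp (log_product (K * norm z))" for z
  proof -
    define D where "D = C * (1 + norm z) ^ k * exp (log_product (K * norm z))"
    have D: "0 \<le> D" using C by (simp add: D_def)
    have sq: "(cmod (cpoly (P n) z))\<^sup>2 \<le> D\<^sup>2 * (w n)\<^sup>2" for n
      using power_mono[OF le[of n z] norm_ge_zero, of 2] by (simp add: D_def power_mult_distrib)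
    have sw: "summable (\<lambda>n. D\<^sup>2 * (w n)\<^sup>2)" by (intro summable_mult w)
    have sP: "summable (\<lambda>n. (cmod (cpoly (P n) z))\<^sup>2)"
      by (rule summable_comparison_test[OF _ sw]) (use sq in auto)
    have "P_fun P z \<le> sqrt (\<Sum>n. D\<^sup>2 * (w n)\<^sup>2)"
      unfolding P_fun_def by (intro real_sqrt_le_mono suminf_le sq sP sw)
    also have "\<dots> = D * sqrt S"
      using D by (simp add: suminf_mult[OF w] S_def real_sqrt_mult)
    also have "\<dots> \<le> D * (sqrt S + 1)" using D by (intro mult_left_mono) auto
    finally show ?thesis using sP by (simp add: D_def mult_ac)
  qed
  moreover have "0 < C * (sqrt S + 1)"
    using C S0 by (intro mult_pos_pos add_nonneg_pos) auto
  ultimately show ?thesis by blast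
qed

lemma summable_cpoly_P: "summable (\<lambda>n. (cmod (cpoly (P n) z))\<^sup>2)"
  using P_fun_bound by blast

lemma P_fun_nonneg: "0 \<le> P_fun P z"
  unfolding P_fun_def by (intro real_sqrt_ge_zero suminf_nonneg summable_cpoly_P) simp

lemma max_modulus_P_fun:
  "\<exists>C>0. \<exists>k. \<forall>r\<ge>0. max_modulus (P_fun P) r \<le> C * (1 + r) ^ k * exp (log_product (K * r))"
  and norm_P_fun_le: "norm z \<le> r \<Longrightarrow> P_fun P z \<le> max_modulus (P_fun P) r"
proof -
  obtain C k where C: "0 < C" and le: "\<And>z. P_fun P z \<le> C * (1 + norm z) ^ k * exp (log_product (K * norm z))"
    using P_fun_bound by blast
  have le': "norm (P_fun P z) \<le> C * (1 + r) ^ k * exp (log_product (K * r))" if "norm z \<le> r" for z r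
  proof -
    have "P_fun P z \<le> C * (1 + norm z) ^ k * exp (log_product (K * norm z))" by (rule le)
    also have "\<dots> \<le> C * (1 + r) ^ k * exp (log_product (K * r))"
    proof (intro mult_mono power_mono)
      show "exp (log_product (K * norm z)) \<le> exp (log_product (K * r))"
        unfolding exp_le_cancel_iff using K that by (intro log_product_mono) auto
      have "0 \<le> r" using that norm_ge_zero order_trans by blast
      then show "0 \<le> C * (1 + r) ^ k" using C by simp
    qed (use C that in auto)
    finally show ?thesis using P_fun_nonneg[of z] by simp
  qed
  have "\<forall>r\<ge>0. max_modulus (P_fun P) r \<le> C * (1 + r) ^ k * exp (log_product (K * r))"
    using le' by (intro allI impI max_modulus_least)
  then show "\<exists>C>0. \<exists>k. \<forall>r\<ge>0. max_modulus (P_fun P) r \<le> C * (1 + r) ^ k * exp (log_product (K * r))"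
    using C by blast
  show "P_fun P z \<le> max_modulus (P_fun P) r" if "norm z \<le> r"
    using max_modulus_upper[of r "P_fun P", OF le' that] P_fun_nonneg[of z] by simp
qed

lemma norm_cpoly_le_P_fun: "norm (cpoly (P n) z) \<le> P_fun P z"
  unfolding P_fun_def
proof (rule real_le_rsqrt)
  have "sum (\<lambda>n. (cmod (cpoly (P n) z))\<^sup>2) {n} \<le> (\<Sum>n. (cmod (cpoly (P n) z))\<^sup>2)"
    by (intro sum_le_suminf summable_cpoly_P) auto
  then show "(cmod (cpoly (P n) z))\<^sup>2 \<le> (\<Sum>n. (cmod (cpoly (P n) z))\<^sup>2)" by simp
qed

lemma max_modulus_P_fun_ge_1: "0 \<le> r \<Longrightarrow> 1 \<le> max_modulus (P_fun P) r"
  using norm_cpoly_le_P_fun[of 0 0] norm_P_fun_le[of 0 r] by (simp add: P_0)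

abbreviation h :: "nat \<Rightarrow> real" where "h n \<equiv> 1 / (\<Prod>k<n. b k)"
abbreviation l :: "nat \<Rightarrow> real" where "l n \<equiv> 1 / sqrt (s (2 * n))"
abbreviation g :: "nat \<Rightarrow> real" where "g n \<equiv> 1 / b n ^ n"

lemma h_le_max_modulus_P_fun:
  assumes r: "0 \<le> r" shows "h n * r ^ n \<le> max_modulus (P_fun P) r"
proof (cases "r = 0")
  case True
  then show ?thesis using max_modulus_P_fun_ge_1[of 0] by (cases n) auto
next
  case False
  have "norm (lead_coeff (map_poly complex_of_real (P n))) * r ^ degree (map_poly complex_of_real (P n))
      \<le> max_modulus (P_fun P) r"
  proof (rule lead_coeff_le_max_modulus)
    fix z :: complex assume "norm z = r"
    then show "norm (cpoly (P n) z) \<le> max_modulus (P_fun P) r"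
      using norm_cpoly_le_P_fun[of n z] norm_P_fun_le[of z r] by simp
  qed (use r False in auto)
  moreover have "norm (coeff (map_poly complex_of_real (P n)) n) = h n"
    using lead_P[of n] by (simp add: coeff_map_poly flip: coeff_P)
  ultimately show ?thesis by (simp add: degree_map_poly)
qed

text \<open>The finite maximum of \<open>P_fun P\<close> on the disc of radius \<open>2 * r\<close>
  bounds all terms there, hence the series at \<open>r\<close>. The coefficients \<open>l\<close>
  and \<open>g\<close> inherit the property by comparison with \<open>h\<close>.\<close>

lemma entire_h: "entire_coeffs h"
  unfolding entire_coeffs_def
proof (intro conjI allI impI)
  show h0: "0 \<le> h n" for n using prod_b_pos[of n] by simp
  fix r :: real assume "0 \<le> r"
  then show "summable (\<lambda>n. h n * r ^ n)"
    by (intro power_series_le_twice_bound[of h r "max_modulus (P_fun P) (2 * r)"] h0 h_le_max_modulus_P_fun) auto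
qed

lemma g_le: "g n \<le> K ^ n * h n"
proof -
  have "(\<Prod>k<n. b k) \<le> (\<Prod>k<n. K * b n)"
    using b_pos mono by (intro prod_mono) (auto simp: less_imp_le)
  then have "(\<Prod>k<n. b k) \<le> K ^ n * b n ^ n"
    by (simp add: power_mult_distrib)
  then show ?thesis
    using prod_b_pos[of n] b_pos[of n] by (simp add: field_simps)
qed

text \<open>The factor \<open>1 ^ n\<close> matches the form of
  \<open>entire_coeffs_scale_le\<close>.\<close>

lemma l_le: "l n \<le> 1 ^ n * h n"
  using prod_b_le_sqrt_moment[of n] prod_b_pos[of n] by (simp add: frac_le)

text \<open>\<open>K'\<close> is a common constant for the diagonal and off-diagonal entries of the
  Jacobi matrix; \<open>3 * K'\<close> is the factor from \<open>sqrt_moment_le\<close>.\<close>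

lemma h_le: "\<exists>K'\<ge>1. \<forall>n. h n \<le> K' ^ n * l n"
proof -
  obtain D where D: "0 \<le> D" "\<And>n. \<bar>a n\<bar> \<le> D * b n" using a_bounded by blast
  define K' where "K' = K + D * K"
  have DK: "0 \<le> D * K" using D K by simp
  have bK: "b k \<le> K' * b j" if "k \<le> j" for k j
  proof -
    have "b k \<le> K * b j" by (rule mono[OF that])
    also have "\<dots> \<le> K' * b j" using DK b_pos[of j] by (intro mult_right_mono) (auto simp: K'_def)
    finally show ?thesis .
  qed
  have aK: "\<bar>a k\<bar> \<le> K' * b j" if "k \<le> j" for k j
  proof -
    have "\<bar>a k\<bar> \<le> D * b k" by (rule D)
    also have "\<dots> \<le> D * (K * b j)" using D by (intro mult_left_mono mono that)
    also have "\<dots> = (D * K) * b j" by simp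
    also have "\<dots> \<le> K' * b j" using K b_pos[of j] by (intro mult_right_mono) (auto simp: K'_def)
    finally show ?thesis .
  qed
  have K': "1 \<le> K'" using K DK by (simp add: K'_def)
  have "h n \<le> (3 * K') ^ n * l n" for n
  proof -
    have "sqrt (s (2 * n)) \<le> (3 * K') ^ n * (\<Prod>k<n. b k)"
      using K' by (intro sqrt_moment_le bK aK) auto
    then show ?thesis
      using prod_b_pos[of n] even_moment_pos[of n] by (simp add: field_simps)
  qed
  then show ?thesis using K' by (intro exI[of _ "3 * K'"]) auto
qed

lemma entire_l: "entire_coeffs l"
  by (rule entire_coeffs_scale_le[OF entire_h _ _ l_le]) (use even_moment_pos in \<open>auto simp: less_imp_le\<close>)

lemma entire_g: "entire_coeffs g"
  by (rule entire_coeffs_scale_le[OF entire_h _ _ g_le]) (use b_pos K in \<open>auto simp: less_imp_le\<close>)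

lemma max_modulus_H: "0 \<le> r \<Longrightarrow> max_modulus (H_fun b) r = (\<Sum>n. h n * r ^ n)"
  using max_modulus_power_series[of h r "\<lambda>n. n"] entire_h
  by (simp add: H_fun_def[abs_def] entire_coeffs_def)

lemma max_modulus_G: "0 \<le> r \<Longrightarrow> max_modulus (G_fun b) r = (\<Sum>n. g n * r ^ n)"
  using max_modulus_power_series[of g r "\<lambda>n. n"] entire_g
  by (simp add: G_fun_def[abs_def] entire_coeffs_def)

lemma max_modulus_L: "0 \<le> r \<Longrightarrow> max_modulus (L_fun s) r = (\<Sum>n. l n * r ^ n)"
  using max_modulus_power_series[of l r "\<lambda>n. n"] entire_l
  by (simp add: L_fun_def[abs_def] entire_coeffs_def)

lemma l_square: "1 / s (2 * n) * r ^ (2 * n) = (l n * r ^ n)\<^sup>2"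
  using even_moment_pos[of n] by (simp add: power_mult_distrib power_divide power_mult mult.commute less_imp_le flip: power_mult)

text \<open>The terms of \<open>F_fun s\<close> at \<open>r\<close> are the squares of those of
  \<open>L_fun s\<close>, and a sum of squares of nonnegative numbers is at most the square of the
  sum.\<close>

lemma summable_F: "0 \<le> r \<Longrightarrow> summable (\<lambda>n. 1 / s (2 * n) * r ^ (2 * n))"
  and F_le_L: "0 \<le> r \<Longrightarrow> (\<Sum>n. 1 / s (2 * n) * r ^ (2 * n)) \<le> (\<Sum>n. l n * r ^ n)\<^sup>2"
proof -
  assume r: "0 \<le> r"
  define S where "S = (\<Sum>n. l n * r ^ n)"
  have sl: "summable (\<lambda>n. l n * r ^ n)" using entire_l r by (simp add: entire_coeffs_def)
  have l0: "0 \<le> l n * r ^ n" for n using entire_l r by (simp add: entire_coeffs_def)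
  have le: "1 / s (2 * n) * r ^ (2 * n) \<le> S * (l n * r ^ n)" for n
    unfolding l_square power2_eq_square S_def
    by (intro mult_right_mono power_series_ge_term[OF entire_l r] l0)
  show sF: "summable (\<lambda>n. 1 / s (2 * n) * r ^ (2 * n))"
    by (rule summable_comparison_test[OF _ summable_mult[OF sl, of S]])
       (use le even_moment_pos r in \<open>auto simp: less_imp_le\<close>)
  have "(\<Sum>n. 1 / s (2 * n) * r ^ (2 * n)) \<le> (\<Sum>n. S * (l n * r ^ n))"
    by (rule suminf_le[OF le sF summable_mult[OF sl]])
  also have "\<dots> = S\<^sup>2" by (simp only: suminf_mult[OF sl] S_def[symmetric] power2_eq_square)
  finally show "(\<Sum>n. 1 / s (2 * n) * r ^ (2 * n)) \<le> (\<Sum>n. l n * r ^ n)\<^sup>2" by (simp only: S_def)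
qed

lemma max_modulus_F: "0 \<le> r \<Longrightarrow> max_modulus (F_fun s) r = (\<Sum>n. 1 / s (2 * n) * r ^ (2 * n))"
  using max_modulus_power_series[of "\<lambda>n. 1 / s (2 * n)" r "\<lambda>n. 2 * n"] summable_F[of r] even_moment_pos
  by (simp add: F_fun_def[abs_def] less_imp_le)

lemma max_modulus_ge_1:
  assumes r: "0 \<le> r"
  shows "1 \<le> max_modulus (F_fun s) r" "1 \<le> max_modulus (G_fun b) r"
    "1 \<le> max_modulus (H_fun b) r" "1 \<le> max_modulus (L_fun s) r"
proof -
  have "sum (\<lambda>n. 1 / s (2 * n) * r ^ (2 * n)) {0} \<le> (\<Sum>n. 1 / s (2 * n) * r ^ (2 * n))"
    using even_moment_pos r by (intro sum_le_suminf summable_F) (auto simp: less_imp_le)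
  then show "1 \<le> max_modulus (F_fun s) r" by (simp add: max_modulus_F r s_0)
  show "1 \<le> max_modulus (G_fun b) r" "1 \<le> max_modulus (H_fun b) r" "1 \<le> max_modulus (L_fun s) r"
    using power_series_ge_term[OF entire_g r, of 0] power_series_ge_term[OF entire_h r, of 0]
      power_series_ge_term[OF entire_l r, of 0] s_0
    by (simp_all add: max_modulus_G max_modulus_H max_modulus_L r)
qed

text \<open>The orders satisfy \<open>E \<le> G \<le> H \<le> P \<le> E\<close>, which closes a
  cycle; \<open>L\<close> is tied to \<open>H\<close>, and \<open>F\<close> to \<open>L\<close>, by
  inequalities in both directions.\<close>

lemma scale_orders:
  assumes "matching_scale T \<psi>"
  defines "E \<equiv> conv_exponent (\<lambda>n. \<psi> (b n))"
  shows "scale_order T (P_fun P) = E" "scale_order T (F_fun s) = E" "scale_order T (G_fun b) = E"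
    "scale_order T (H_fun b) = E" "scale_order T (L_fun s) = E"
proof -
  interpret matching_scale T \<psi> by fact
  have ge0: "0 \<le> max_modulus (P_fun P) r" "0 \<le> max_modulus (F_fun s) r" "0 \<le> max_modulus (G_fun b) r"
    "0 \<le> max_modulus (H_fun b) r" "0 \<le> max_modulus (L_fun s) r" if "0 \<le> r" for r
    using max_modulus_ge_1[OF that] max_modulus_P_fun_ge_1[OF that] by linarith+
  have EG: "E \<le> scale_order T (G_fun b)"
    unfolding E_def conv_exponent_eq scale_order_def
  proof (rule Inf_ereal_image_le, safe)
    fix a a' :: real
    assume a: "0 < a" "a < a'" and ev: "\<forall>\<^sub>F r in at_top. max_modulus (G_fun b) r \<le> exp (T a r)"
    have "\<forall>\<^sub>F r in at_top. \<forall>n. (r / b n) ^ n \<le> exp (T a r)"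
      using ev eventually_ge_at_top[of 0]
    proof eventually_elim
      case (elim r)
      show ?case
      proof
        fix n
        have "(r / b n) ^ n = g n * r ^ n" by (simp add: power_divide)
        also have "\<dots> \<le> max_modulus (G_fun b) r"
          using elim power_series_ge_term[OF entire_g] by (simp add: max_modulus_G)
        finally show "(r / b n) ^ n \<le> exp (T a r)" using elim by simp
      qed
    qed
    then show "a' \<in> conv_set (\<lambda>n. \<psi> (b n))"
      by (rule conv_setI_coeff[OF almost_inc a(1) _ a(2)])
  qed
  have GH: "scale_order T (G_fun b) \<le> scale_order T (H_fun b)"
  proof (rule scale_order_mono[OF scale, of 1 K _ _ 1])
    show "\<forall>\<^sub>F r in at_top. max_modulus (G_fun b) r \<le> 1 * max_modulus (H_fun b) (K * r) ^ 1"
      using eventually_ge_at_top[of 0]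
    proof eventually_elim
      case (elim r)
      then show ?case
        using entire_coeffs_scale_le(2)[OF entire_h _ _ g_le] K b_pos
        by (simp add: max_modulus_G max_modulus_H less_imp_le)
    qed
  qed (use K ge0 in auto)
  have HP: "scale_order T (H_fun b) \<le> scale_order T (P_fun P)"
  proof (rule scale_order_mono[OF scale, of 2 2 _ _ 1])
    show "\<forall>\<^sub>F r in at_top. max_modulus (H_fun b) r \<le> 2 * max_modulus (P_fun P) (2 * r) ^ 1"
      using eventually_ge_at_top[of 0]
    proof eventually_elim
      case (elim r)
      then show ?case
        using power_series_le_twice_bound(2)[of h r "max_modulus (P_fun P) (2 * r)"]
          h_le_max_modulus_P_fun[of "2 * r"] prod_b_pos
        by (simp add: max_modulus_H less_imp_le)
    qed
  qed (use ge0 in auto)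
  have PE: "scale_order T (P_fun P) \<le> E"
    unfolding E_def conv_exponent_eq scale_order_def
  proof (rule Inf_ereal_image_le, safe)
    fix a a' :: real
    assume a: "a \<in> conv_set (\<lambda>n. \<psi> (b n))" "a < a'"
    then have a0: "0 < a" by (auto simp: conv_set_def)
    then show "0 < a'" using a by simp
    obtain C k where C: "0 < C"
      and le: "\<And>r. 0 \<le> r \<Longrightarrow> max_modulus (P_fun P) r \<le> C * (1 + r) ^ k * exp (log_product (K * r))"
      using max_modulus_P_fun by blast
    \<comment> \<open>Exponent is lost twice, in \<open>product_le\<close> and in absorbing the
      prefactor and the dilation by \<open>K\<close>; the midpoint leaves room for both.\<close>
    define c where "c = (a + a') / 2"
    have c: "0 < c" "a < c" "c < a'" using a a0 by (auto simp: c_def)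
    have "\<forall>\<^sub>F r in at_top. exp (log_product r) \<le> exp (T c r)"
      using product_le[OF almost_inc a(1) c(2)] by simp
    moreover have "0 < K" using K by simp
    ultimately have "\<forall>\<^sub>F r in at_top. C * (1 + r) ^ k * exp (log_product (K * r)) ^ 1 \<le> exp (T a' r)"
      by (intro exp_growth_scale_absorb[where g = "\<lambda>r. exp (log_product r)", OF scale c(1,3)] C) auto
    then show "\<forall>\<^sub>F r in at_top. max_modulus (P_fun P) r \<le> exp (T a' r)"
      using eventually_ge_at_top[of 0]
    proof eventually_elim
      case (elim r)
      then show ?case using le[of r] by simp
    qed
  qed
  have LH: "scale_order T (L_fun s) \<le> scale_order T (H_fun b)"
  proof (rule scale_order_mono[OF scale, of 1 1 _ _ 1])
    show "\<forall>\<^sub>F r in at_top. max_modulus (L_fun s) r \<le> 1 * max_modulus (H_fun b) (1 * r) ^ 1"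
      using eventually_ge_at_top[of 0]
    proof eventually_elim
      case (elim r)
      then show ?case
        using entire_coeffs_scale_le(2)[OF entire_h _ _ l_le, of r] even_moment_pos
        by (simp add: max_modulus_L max_modulus_H less_imp_le)
    qed
  qed (use ge0 in auto)
  have HL: "scale_order T (H_fun b) \<le> scale_order T (L_fun s)"
  proof -
    obtain K' where K': "1 \<le> K'" "\<And>n. h n \<le> K' ^ n * l n" using h_le by blast
    show ?thesis
    proof (rule scale_order_mono[OF scale, of 1 K' _ _ 1])
      show "\<forall>\<^sub>F r in at_top. max_modulus (H_fun b) r \<le> 1 * max_modulus (L_fun s) (K' * r) ^ 1"
        using eventually_ge_at_top[of 0]
      proof eventually_elim
        case (elim r)
        then show ?case
          using entire_coeffs_scale_le(2)[OF entire_l _ _ K'(2), of r] prod_b_pos K'(1)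
          by (simp add: max_modulus_L max_modulus_H less_imp_le)
      qed
    qed (use K' ge0 in auto)
  qed
  have FL: "scale_order T (F_fun s) \<le> scale_order T (L_fun s)"
  proof (rule scale_order_mono[OF scale, of 1 1 _ _ 2])
    show "\<forall>\<^sub>F r in at_top. max_modulus (F_fun s) r \<le> 1 * max_modulus (L_fun s) (1 * r) ^ 2"
      using eventually_ge_at_top[of 0]
    proof eventually_elim
      case (elim r)
      then show ?case using F_le_L[of r] by (simp add: max_modulus_L max_modulus_F)
    qed
  qed (use ge0 in auto)
  have LF: "scale_order T (L_fun s) \<le> scale_order T (F_fun s)"
  proof (rule scale_order_mono[OF scale, of 2 2 _ _ 1])
    show "\<forall>\<^sub>F r in at_top. max_modulus (L_fun s) r \<le> 2 * max_modulus (F_fun s) (2 * r) ^ 1"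
      using eventually_ge_at_top[of 0]
    proof eventually_elim
      case (elim r)
      \<comment> \<open>Squaring helps only when the term of \<open>L_fun s\<close> exceeds
        \<open>1\<close>; a smaller term is covered by the constant term \<open>1\<close> of
        \<open>F_fun s\<close>.\<close>
      have "l n * (2 * r) ^ n \<le> max_modulus (F_fun s) (2 * r)" for n
      proof -
        define x where "x = l n * (2 * r) ^ n"
        have x0: "0 \<le> x" using elim even_moment_pos[of n] by (simp add: x_def)
        have "sum (\<lambda>n. 1 / s (2 * n) * (2 * r) ^ (2 * n)) {n} \<le> (\<Sum>n. 1 / s (2 * n) * (2 * r) ^ (2 * n))"
          using even_moment_pos elim by (intro sum_le_suminf summable_F) (auto simp: less_imp_le)
        then have F: "x\<^sup>2 \<le> max_modulus (F_fun s) (2 * r)"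
          using elim by (simp only: max_modulus_F l_square x_def sum.insert_remove) (simp add: max_modulus_F)
        show ?thesis
        proof (cases "x \<le> 1")
          case True
          then show ?thesis using max_modulus_ge_1(1)[of "2 * r"] elim by (simp add: x_def)
        next
          case False
          then have "x \<le> x\<^sup>2" by (simp add: power2_eq_square)
          with F show ?thesis by (simp add: x_def)
        qed
      qed
      then show ?case
        using power_series_le_twice_bound(2)[of l r "max_modulus (F_fun s) (2 * r)"] elim even_moment_pos
        by (simp add: max_modulus_L less_imp_le)
    qed
  qed (use ge0 in auto)
  from EG GH HP PE LH HL FL LF
  show "scale_order T (P_fun P) = E" "scale_order T (F_fun s) = E" "scale_order T (G_fun b) = E"
    "scale_order T (H_fun b) = E" "scale_order T (L_fun s) = E"
    by (meson order.antisym order.trans)+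
qed

lemma growth_orders:
  defines "E \<equiv> conv_exponent b"
  shows "growth_order (P_fun P) = E" "growth_order (F_fun s) = E" "growth_order (G_fun b) = E"
    "growth_order (H_fun b) = E" "growth_order (L_fun s) = E"
proof -
  have pos: "\<forall>\<^sub>F r in at_top. 0 < M r" if "\<And>r. 0 \<le> r \<Longrightarrow> 1 \<le> M r" for M :: "real \<Rightarrow> real"
    using eventually_ge_at_top[of 0] by eventually_elim (use that in force)
  note eq = growth_order_eq_scale_order[OF pos]
  show "growth_order (P_fun P) = E" "growth_order (F_fun s) = E" "growth_order (G_fun b) = E"
    "growth_order (H_fun b) = E" "growth_order (L_fun s) = E"
    using scale_orders[OF matching_scale_order]
    by (simp_all add: eq max_modulus_P_fun_ge_1 max_modulus_ge_1 E_def)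
qed

lemma log_orders:
  defines "E \<equiv> conv_exponent (\<lambda>n. ln (b n))"
  shows "log_order (P_fun P) = E" "log_order (F_fun s) = E" "log_order (G_fun b) = E"
    "log_order (H_fun b) = E" "log_order (L_fun s) = E"
  unfolding log_order_eq_scale_order E_def
  by (rule scale_orders[OF log_weight.matching_scale_log[OF log_weight_ln]])+

lemma loglog_orders:
  defines "E \<equiv> conv_exponent (\<lambda>n. ln (ln (b n)))"
  shows "loglog_order (P_fun P) = E" "loglog_order (F_fun s) = E" "loglog_order (G_fun b) = E"
    "loglog_order (H_fun b) = E" "loglog_order (L_fun s) = E"
  unfolding loglog_order_eq_scale_order E_def
  by (rule scale_orders[OF log_weight.matching_scale_log[OF log_weight_ln_ln]])+

end

section \<open>Real-rooted polynomials\<close>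

lemma degree_le_Suc0_cases:
  assumes "degree p \<le> Suc 0" obtains u v where "p = [:u, v:]"
proof -
  obtain u p' where p: "p = pCons u p'" by (cases p)
  then have "degree p' = 0" using assms by (auto split: if_splits)
  then obtain v where "p' = [:v:]" by (rule degree_eq_zeroE)
  with p show thesis using that by blast
qed

text \<open>Division by the quadratic with roots \<open>z\<close> and its conjugate leaves a real
  remainder of degree at most one, and such a polynomial with a nonreal zero is zero.\<close>

lemma quadratic_dvd_if_nonreal_root:
  assumes root: "cpoly q z = 0" and im: "Im z \<noteq> 0"
  shows "[:(Re z)\<^sup>2 + (Im z)\<^sup>2, - 2 * Re z, 1:] dvd q"
proof -
  define d where "d = [:(Re z)\<^sup>2 + (Im z)\<^sup>2, - 2 * Re z, 1:]"
  have dz: "cpoly d z = 0"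
    by (simp add: d_def cpoly_pCons complex_eq_iff power2_eq_square algebra_simps)
  have "degree d = 2" "d \<noteq> 0" by (simp_all add: d_def)
  then have "q mod d = 0 \<or> degree (q mod d) < 2" using degree_mod_less[of d q] by auto
  then have "degree (q mod d) \<le> Suc 0" by auto
  then obtain u v where uv: "q mod d = [:u, v:]"
    by (metis degree_le_Suc0_cases)
  have "cpoly q z = cpoly (q div d) z * cpoly d z + cpoly (q mod d) z"
    by (metis cpoly_add cpoly_mult div_mult_mod_eq)
  then have "of_real u + z * of_real v = 0"
    using root dz uv by (simp add: cpoly_pCons)
  then have "u + Re z * v = 0" "Im z * v = 0"
    by (auto simp: complex_eq_iff)
  with im have "v = 0" "u = 0" by auto
  then have "d dvd q" using uv by (simp add: mod_eq_0_iff_dvd)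
  then show ?thesis unfolding d_def .
qed

text \<open>The excluded divisors are exactly the monic quadratics that are nonnegative on the real
  line, the ones that quasi-orthogonality can refute. Without them every complex root is real, and
  splitting it off leaves a factor that no longer vanishes there.\<close>

lemma real_rooted_card:
  fixes q :: "real poly"
  assumes "q \<noteq> 0"
    and "\<And>\<alpha> \<beta>. \<beta> \<noteq> 0 \<Longrightarrow> \<not> [:\<alpha>\<^sup>2 + \<beta>\<^sup>2, - 2 * \<alpha>, 1:] dvd q"
    and "\<And>t. \<not> [:-t, 1:] * [:-t, 1:] dvd q"
  shows "card {x. poly q x = 0} = degree q"
  using assms
proof (induction "degree q" arbitrary: q)
  case 0
  then obtain c where "q = [:c:]" by (metis degree_eq_zeroE)
  then show ?case using 0 by simp
next
  case (Suc n)
  have "\<not> constant (poly (map_poly complex_of_real q))"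
    using Suc.hyps(2) by (simp add: constant_degree degree_map_poly)
  then obtain z where z: "cpoly q z = 0"
    using fundamental_theorem_of_algebra by blast
  have "Im z = 0" using quadratic_dvd_if_nonreal_root[OF z] Suc.prems(2)[of "Im z" "Re z"] by blast
  then have "z = of_real (Re z)" by (simp add: complex_eq_iff)
  define t where "t = Re z"
  have "poly q t = 0" using z \<open>z = _\<close> cpoly_of_real[of q t] unfolding t_def by (metis of_real_eq_0_iff)
  then obtain r where r: "q = [:-t, 1:] * r" by (metis poly_eq_0_iff_dvd dvdE)
  have r0: "r \<noteq> 0" using r Suc.prems(1) by auto
  have deg: "degree q = Suc (degree r)" using r0 unfolding r by (subst degree_mult_eq) auto
  have "card {x. poly r x = 0} = degree r"
  proof (rule Suc.hyps(1))
    show "n = degree r" using deg Suc.hyps(2) by simp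
    show "r \<noteq> 0" by fact
    show "\<not> [:\<alpha>\<^sup>2 + \<beta>\<^sup>2, - 2 * \<alpha>, 1:] dvd r" if "\<beta> \<noteq> 0" for \<alpha> \<beta>
      using Suc.prems(2)[OF that] unfolding r by (metis dvd_mult)
    show "\<not> [:-x, 1:] * [:-x, 1:] dvd r" for x
      using Suc.prems(3) unfolding r by (metis dvd_mult)
  qed
  moreover have "poly r t \<noteq> 0"
  proof
    assume "poly r t = 0"
    then have "[:-t, 1:] dvd r" by (simp add: poly_eq_0_iff_dvd)
    then have "[:-t, 1:] * [:-t, 1:] dvd q" unfolding r by (rule mult_dvd_mono[OF dvd_refl])
    then show False using Suc.prems(3) by blast
  qed
  moreover have "{x. poly q x = 0} = insert t {x. poly r x = 0}"
    by (auto simp: r)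
  moreover have "finite {x. poly r x = 0}" by (rule poly_roots_finite[OF r0])
  ultimately show ?case using deg by simp
qed

section \<open>Gauss quadrature with a prescribed node\<close>

context hamburger
begin

text \<open>The nodes are the zeros of a quasi-orthogonal polynomial of degree \<open>n + 1\<close> vanishing at \<open>x0\<close>.
  A quadratic factor without sign change would contradict quasi-orthogonality.\<close>

lemma gauss_quadrature:
  assumes x0: "poly (P n) x0 \<noteq> 0"
  shows "\<exists>X w. finite X \<and> x0 \<in> X \<and> (\<forall>t\<in>X. 0 \<le> w t) \<and>
    (\<forall>p. degree p \<le> 2 * n \<longrightarrow> \<Lambda> p = (\<Sum>t\<in>X. w t * poly p t)) \<and>
    1 \<le> w x0 * (\<Sum>k\<le>n. (poly (P k) x0)\<^sup>2)"
proof -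
  \<comment> \<open>Vanishing at \<open>x0\<close> fixes the combination up to a scalar; the nonzero
    value of \<open>P n\<close> at \<open>x0\<close> keeps the degree at
    \<open>n + 1\<close>.\<close>
  define q where "q = smult (poly (P n) x0) (P (Suc n)) - smult (poly (P (Suc n)) x0) (P n)"
  have degq: "degree q = Suc n"
  proof (rule antisym)
    show "degree q \<le> Suc n"
      unfolding q_def by (intro degree_diff_le order_trans[OF degree_smult_le]) auto
    have "coeff q (Suc n) \<noteq> 0"
      using x0 lead_P[of "Suc n"] by (simp add: q_def coeff_eq_0)
    then show "Suc n \<le> degree q" by (rule le_degree)
  qed
  then have q0: "q \<noteq> 0" by auto
  have qx0: "poly q x0 = 0" by (simp add: q_def)
  have quasi: "\<Lambda> (q * r) = 0" if "degree r < n" for r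
  proof -
    have "\<Lambda> (q * r) = poly (P n) x0 * \<Lambda> (r * P (Suc n)) - poly (P (Suc n)) x0 * \<Lambda> (r * P n)"
      by (simp add: q_def left_diff_distrib \<Lambda>_diff \<Lambda>_smult mult.commute[of r])
    then show ?thesis using that by (simp add: \<Lambda>_lower_degree)
  qed
  \<comment> \<open>If \<open>q = d * r\<close>, then \<open>r\<close> has degree
    \<open>n - 1\<close>, so \<open>\<Lambda> (d * (r * r)) = \<Lambda> (q * r) = 0\<close>, against
    positivity.\<close>
  have no_def: False if d: "degree d = 2" "d dvd q" and pos: "\<And>r. r \<noteq> 0 \<Longrightarrow> 0 < \<Lambda> (d * (r * r))" for d
  proof -
    obtain r where r: "q = d * r" using d(2) by (rule dvdE)
    have "r \<noteq> 0" "d \<noteq> 0" using r q0 by auto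
    then have "degree q = 2 + degree r" using d r by (simp add: degree_mult_eq)
    then have "\<Lambda> (q * r) = 0" using degq by (intro quasi) simp
    then show False using pos[OF \<open>r \<noteq> 0\<close>] by (simp add: r mult.assoc)
  qed
  define X where "X = {x. poly q x = 0}"
  have cardX: "card X = Suc n"
    unfolding X_def degq[symmetric]
  proof (rule real_rooted_card[OF q0])
    fix \<alpha> \<beta> :: real assume \<beta>: "\<beta> \<noteq> 0"
    define d where "d = [:\<alpha>\<^sup>2 + \<beta>\<^sup>2, - 2 * \<alpha>, 1:]"
    have d: "d = [:-\<alpha>, 1:] * [:-\<alpha>, 1:] + [:\<beta>\<^sup>2:]"
      by (simp add: d_def power2_eq_square)
    show "\<not> [:\<alpha>\<^sup>2 + \<beta>\<^sup>2, - 2 * \<alpha>, 1:] dvd q"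
    proof
      assume "[:\<alpha>\<^sup>2 + \<beta>\<^sup>2, - 2 * \<alpha>, 1:] dvd q"
      then have "d dvd q" by (simp add: d_def)
      moreover have "degree d = 2" by (simp add: d_def)
      moreover have "0 < \<Lambda> (d * (r * r))" if "r \<noteq> 0" for r
      proof -
        define u where "u = [:-\<alpha>, 1:] * r"
        have "u \<noteq> 0" using that by (simp add: u_def del: mult_pCons_left)
        have "d * (r * r) = u * u + smult (\<beta>\<^sup>2) (r * r)"
          unfolding d u_def by (simp add: distrib_right mult_ac del: mult_pCons_left mult_pCons_right) (simp add: algebra_simps smult_add_left)
        then have "\<Lambda> (d * (r * r)) = \<Lambda> (u * u) + \<beta>\<^sup>2 * \<Lambda> (r * r)"
          by (simp add: \<Lambda>_add \<Lambda>_smult)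
        then show ?thesis
          using \<Lambda>_square_pos[OF that] \<Lambda>_square_pos[OF \<open>u \<noteq> 0\<close>] \<beta> by (simp add: add_pos_pos)
      qed
      ultimately show False using no_def by blast
    qed
  next
    fix t :: real
    show "\<not> [:-t, 1:] * [:-t, 1:] dvd q"
    proof
      assume "[:-t, 1:] * [:-t, 1:] dvd q"
      moreover have "degree ([:-t, 1:] * [:-t, 1:]) = 2" by simp
      moreover have "0 < \<Lambda> (([:-t, 1:] * [:-t, 1:]) * (r * r))" if "r \<noteq> 0" for r
      proof -
        have "[:-t, 1:] * r \<noteq> 0" using that by (simp del: mult_pCons_left)
        from \<Lambda>_square_pos[OF this] show ?thesis
          by (simp only: mult_ac)
      qed
      ultimately show False using no_def by blast
    qed
  qed
  have finX: "finite X" unfolding X_def by (rule poly_roots_finite[OF q0])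
  have "\<forall>t\<in>X. \<exists>l. degree l \<le> n \<and> (\<forall>u\<in>X. poly l u = (if u = t then 1 else 0))"
  proof
    fix t assume t: "t \<in> X"
    \<comment> \<open>The Lagrange basis polynomial of the node \<open>t\<close>.\<close>
    define l where "l = (\<Prod>u\<in>X - {t}. smult (1 / (t - u)) [:-u, 1:])"
    have "degree l \<le> (\<Sum>u\<in>X - {t}. degree (smult (1 / (t - u)) [:-u, 1:]))"
      unfolding l_def by (rule order_trans[OF degree_prod_sum_le]) (use finX in auto)
    also have "\<dots> \<le> (\<Sum>u\<in>X - {t}. 1)"
      by (intro sum_mono order_trans[OF degree_smult_le]) simp
    also have "\<dots> = n" using cardX t finX by simp
    finally have "degree l \<le> n" .
    moreover have "poly l u = (if u = t then 1 else 0)" if "u \<in> X" for u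
    proof -
      have "poly l u = (\<Prod>v\<in>X - {t}. (u - v) / (t - v))"
        by (simp add: l_def poly_prod diff_divide_distrib)
      also have "\<dots> = (if u = t then 1 else 0)"
        using that finX by (auto intro!: prod.neutral)
      finally show ?thesis .
    qed
    ultimately show "\<exists>l. degree l \<le> n \<and> (\<forall>u\<in>X. poly l u = (if u = t then 1 else 0))" by blast
  qed
  then obtain l where l: "\<And>t. t \<in> X \<Longrightarrow> degree (l t) \<le> n"
      "\<And>t u. t \<in> X \<Longrightarrow> u \<in> X \<Longrightarrow> poly (l t) u = (if u = t then 1 else 0)"
    by metis
  define w where "w t = \<Lambda> (l t)" for t
  have exact: "\<Lambda> p = (\<Sum>t\<in>X. w t * poly p t)" if p: "degree p \<le> 2 * n" for p
  proof -
    \<comment> \<open>The error of Lagrange interpolation vanishes at all nodes, hence is a multiple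
      \<open>q * e\<close>. The degree is limited to \<open>2 * n\<close> because
      quasi-orthogonality covers only cofactors \<open>e\<close> of degree below
      \<open>n\<close>.\<close>
    define D where "D = p - (\<Sum>t\<in>X. smult (poly p t) (l t))"
    have "degree (\<Sum>t\<in>X. smult (poly p t) (l t)) \<le> 2 * n"
      by (rule degree_sum_le[OF finX]) (metis degree_smult_le l(1) le_add1 mult_2 order_trans)
    then have degD: "degree D \<le> 2 * n" unfolding D_def using p by (rule degree_diff_le[rotated])
    have DX: "poly D u = 0" if "u \<in> X" for u
    proof -
      have "(\<Sum>t\<in>X. poly p t * poly (l t) u) = (\<Sum>t\<in>X. if t = u then poly p t else 0)"
        using that by (intro sum.cong) (auto simp: l(2))
      then show ?thesis using that finX by (simp add: D_def poly_sum)
    qed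
    have "D mod q = 0"
    proof (rule ccontr)
      assume "D mod q \<noteq> 0"
      then have "degree (D mod q) < Suc n" using degree_mod_less[OF q0, of D] degq by auto
      moreover have "X \<subseteq> {x. poly (D mod q) x = 0}"
      proof
        fix u assume u: "u \<in> X"
        have "poly D u = poly (D div q) u * poly q u + poly (D mod q) u"
          by (metis div_mult_mod_eq poly_add poly_mult)
        then show "u \<in> {x. poly (D mod q) x = 0}" using DX[OF u] u by (simp add: X_def)
      qed
      then have "card X \<le> card {x. poly (D mod q) x = 0}"
        using \<open>D mod q \<noteq> 0\<close> by (intro card_mono poly_roots_finite)
      moreover have "card {x. poly (D mod q) x = 0} \<le> degree (D mod q)"
        using \<open>D mod q \<noteq> 0\<close> by (rule card_poly_roots_bound)
      ultimately show False using cardX by simp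
    qed
    then obtain e where e: "D = q * e" by (metis mod_eq_0_iff_dvd dvdE)
    have "\<Lambda> D = 0"
    proof (cases "e = 0")
      case True
      then show ?thesis by (simp add: e)
    next
      case False
      then have "degree D = Suc n + degree e" using q0 by (simp add: e degree_mult_eq degq)
      then have "degree e < n" using degD by simp
      then show ?thesis unfolding e by (rule quasi)
    qed
    then show ?thesis
      by (simp add: D_def \<Lambda>_diff \<Lambda>_sum \<Lambda>_smult w_def mult.commute)
  qed
  \<comment> \<open>Exactness for the square of a Lagrange polynomial, of degree at most
    \<open>2 * n\<close>, exhibits the weight as the functional of a square.\<close>
  have w_eq: "w t = \<Lambda> (l t * l t)" if t: "t \<in> X" for t
  proof -
    have "degree (l t * l t) \<le> 2 * n"
      using degree_mult_le[of "l t" "l t"] l(1)[OF t] by simp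
    then have "\<Lambda> (l t * l t) = (\<Sum>u\<in>X. w u * poly (l t * l t) u)" by (rule exact)
    also have "\<dots> = (\<Sum>u\<in>X. if u = t then w u else 0)"
      using t by (intro sum.cong) (auto simp: l(2))
    also have "\<dots> = w t" using t finX by simp
    finally show ?thesis by simp
  qed
  have w0: "0 \<le> w t" if "t \<in> X" for t
  proof -
    have "l t \<noteq> 0" using l(2)[OF that that] by auto
    then show ?thesis using \<Lambda>_square_pos[of "l t"] w_eq[OF that] by simp
  qed
  have x0X: "x0 \<in> X" by (simp add: X_def qx0)
  \<comment> \<open>Cauchy-Schwarz for the expansion of \<open>f\<close> at \<open>x0\<close>,
    together with Parseval, bounds the weight below by the Christoffel function.\<close>
  define f where "f = l x0"
  have f1: "poly f x0 = 1" using l(2)[OF x0X x0X] by (simp add: f_def)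
  have "f = (\<Sum>k\<le>n. smult (\<Lambda> (f * P k)) (P k))"
    unfolding f_def by (rule P_expansion) (rule l(1)[OF x0X])
  then have "poly f x0 = (\<Sum>k\<le>n. \<Lambda> (f * P k) * poly (P k) x0)"
    by (metis (mono_tags, lifting) poly_smult poly_sum sum.cong)
  then have "1 = (\<Sum>k\<le>n. \<Lambda> (f * P k) * poly (P k) x0)\<^sup>2" using f1 by simp
  also have "\<dots> \<le> (\<Sum>k\<le>n. (\<Lambda> (f * P k))\<^sup>2) * (\<Sum>k\<le>n. (poly (P k) x0)\<^sup>2)"
    by (rule Cauchy_Schwarz_ineq_sum)
  also have "(\<Sum>k\<le>n. (\<Lambda> (f * P k))\<^sup>2) = w x0"
    using parseval[of f n] l(1)[OF x0X] w_eq[OF x0X] by (simp add: f_def)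
  finally show ?thesis using finX x0X w0 exact by blast
qed

end

section \<open>Limits of finitely supported measures\<close>

lemma ex_finite_distribution:
  fixes X :: "real set" and w :: "real \<Rightarrow> real"
  assumes X: "finite X" and w: "\<And>t. t \<in> X \<Longrightarrow> 0 \<le> w t" and sum: "(\<Sum>t\<in>X. w t) = 1"
  shows "\<exists>M. real_distribution M \<and> (\<forall>g\<in>borel_measurable borel. integrable M g \<and>
    (LINT x|M. g x) = (\<Sum>t\<in>X. w t * (g t :: real)))"
proof -
  define N where "N = point_measure X (\<lambda>t. ennreal (w t))"
  interpret N: prob_space N
  proof
    have "emeasure N X = (\<Sum>t\<in>X. ennreal (w t))"
      unfolding N_def using X by (simp add: emeasure_point_measure_finite)
    also have "\<dots> = ennreal 1" using w sum by (simp add: sum_ennreal)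
    finally show "emeasure N (space N) = 1" by (simp add: N_def space_point_measure)
  qed
  have m: "(\<lambda>x. x) \<in> borel_measurable N" by (simp add: N_def)
  define M where "M = distr N borel (\<lambda>x. x)"
  have "real_distribution M" unfolding M_def by (rule N.real_distribution_distr[OF m])
  moreover have "integrable M g \<and> (LINT x|M. g x) = (\<Sum>t\<in>X. w t * g t)"
    if g: "g \<in> borel_measurable borel" for g :: "real \<Rightarrow> real"
  proof
    show "integrable M g"
      unfolding M_def using X w by (subst integrable_distr_eq[OF m g]) (auto simp: N_def intro!: integrable_point_measure_finite)
    show "(LINT x|M. g x) = (\<Sum>t\<in>X. w t * g t)"
      unfolding M_def integral_distr[OF m g] unfolding N_def
      using X w by (subst lebesgue_integral_point_measure_finite) auto
  qed
  ultimately show ?thesis by blast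
qed

text \<open>A bounded continuous stand-in for \<open>x\<close>; its powers replace the monomials as
  test functions for weak convergence.\<close>

definition clamp_at :: "real \<Rightarrow> real \<Rightarrow> real" where
  "clamp_at R x = max (- R) (min R x)"

lemma clamp_at_continuous: "isCont (\<lambda>x. clamp_at R x ^ k) x"
  unfolding clamp_at_def by (intro continuous_intros)

lemma clamp_at_bound: "0 \<le> R \<Longrightarrow> \<bar>clamp_at R x ^ k\<bar> \<le> R ^ k"
  unfolding power_abs clamp_at_def by (intro power_mono) auto

lemma clamp_at_measurable [measurable]: "(\<lambda>x. clamp_at R x ^ k) \<in> borel_measurable borel"
  unfolding clamp_at_def by measurable

text \<open>Outside the interval \<open>\<bar>x\<bar> / R > 1\<close>, so an extra factor
  \<open>(\<bar>x\<bar> / R) ^ k\<close> only enlarges the bound. The moment of order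
  \<open>2 * k\<close> thus controls the error for all measures at once.\<close>

lemma clamp_at_error:
  assumes R: "0 < R"
  shows "\<bar>x ^ k - clamp_at R x ^ k\<bar> \<le> x ^ (2 * k) / R ^ k"
proof (cases "\<bar>x\<bar> \<le> R")
  case True
  then have "clamp_at R x = x" by (auto simp: clamp_at_def)
  then show ?thesis using R by (simp add: power_mult)
next
  case False
  have pos: "\<bar>y ^ k - R ^ k\<bar> \<le> y ^ (2 * k) / R ^ k" if "R < y" for y
  proof -
    have le: "R ^ k \<le> y ^ k" using R that by (intro power_mono) auto
    then have "\<bar>y ^ k - R ^ k\<bar> \<le> y ^ k" using R by simp
    also have "\<dots> \<le> y ^ k * (y ^ k / R ^ k)"
      using mult_left_mono[of 1 "y ^ k / R ^ k" "y ^ k"] le R that by simp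
    finally show ?thesis by (simp add: mult_2 power_add)
  qed
  show ?thesis
  proof (cases "x > 0")
    case True
    then have "clamp_at R x = R" "R < x" using False R by (auto simp: clamp_at_def)
    then show ?thesis using pos by simp
  next
    case neg: False
    then have *: "clamp_at R x = - R" "R < - x" using False R by (auto simp: clamp_at_def)
    have "x ^ k - clamp_at R x ^ k = (-1) ^ k * ((- x) ^ k - R ^ k)"
      using power_minus[of "- x" k] power_minus[of R k] by (simp add: * algebra_simps)
    then have "\<bar>x ^ k - clamp_at R x ^ k\<bar> = \<bar>(- x) ^ k - R ^ k\<bar>"
      by (simp add: abs_mult power_abs)
    also have "\<dots> \<le> (- x) ^ (2 * k) / R ^ k" by (rule pos) fact
    also have "(- x) ^ (2 * k) = x ^ (2 * k)" by (simp add: power_mult)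
    finally show ?thesis .
  qed
qed

text \<open>Chebyshev's inequality, obtained by integrating a downward parabola that lies below the
  indicator of \<open>{-R<..R}\<close>.\<close>

lemma tight_if_second_moment:
  assumes M: "\<And>n. real_distribution (M n)" and int: "\<And>n. integrable (M n) (\<lambda>x. x\<^sup>2)"
    and le: "\<And>n. (LINT x|M n. x\<^sup>2) \<le> B"
  shows "tight M"
  unfolding tight_def
proof (intro conjI allI impI M)
  fix \<epsilon> :: real assume \<epsilon>: "0 < \<epsilon>"
  \<comment> \<open>\<open>\<bar>B\<bar> + 1\<close> keeps the radicand positive and makes the
    Chebyshev bound strictly smaller than \<open>\<epsilon>\<close>.\<close>
  define R where "R = sqrt ((\<bar>B\<bar> + 1) / \<epsilon>)"
  have R: "0 < R" "R\<^sup>2 = (\<bar>B\<bar> + 1) / \<epsilon>" using \<epsilon> by (auto simp: R_def intro!: divide_pos_pos)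
  have "1 - \<epsilon> < measure (M n) {-R<..R}" for n
  proof -
    interpret real_distribution "M n" by (rule M)
    have "B * \<epsilon> < (\<bar>B\<bar> + 1) * \<epsilon>" using \<epsilon> by (intro mult_strict_right_mono) auto
    then have "B / R\<^sup>2 < \<epsilon>" using \<epsilon> by (simp add: R field_simps)
    then have "1 - \<epsilon> < 1 - B / R\<^sup>2" by simp
    also have "\<dots> \<le> 1 - (LINT x|M n. x\<^sup>2) / R\<^sup>2"
      using le[of n] R(1) by (simp add: divide_right_mono)
    also have "\<dots> = (LINT x|M n. 1 - x\<^sup>2 / R\<^sup>2)"
      using int[of n] prob_space by simp
    also have "\<dots> \<le> (LINT x|M n. indicator {-R<..R} x)"
    proof (rule integral_mono)
      show "1 - x\<^sup>2 / R\<^sup>2 \<le> indicator {-R<..R} x" for x :: real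
      proof (cases "x \<in> {-R<..R}")
        case False
        then have "R\<^sup>2 \<le> x\<^sup>2" using R(1) by (auto simp: abs_le_square_iff[symmetric])
        then show ?thesis using R(1) False by simp
      qed simp
      show "integrable (M n) (indicator {-R<..R} :: real \<Rightarrow> real)"
        by (intro integrable_real_indicator) (auto simp: emeasure_finite less_top[symmetric])
    qed (use int[of n] in auto)
    also have "\<dots> = measure (M n) {-R<..R}" by simp
    finally show ?thesis .
  qed
  then show "\<exists>a b. a < b \<and> (\<forall>n. 1 - \<epsilon> < measure (M n) {a<..b})"
    using R(1) by (intro exI[of _ "- R"] exI[of _ R]) auto
qed

text \<open>Monotone convergence in the truncation level gives only an upper bound for the even
  moments of \<open>N\<close>, but that suffices to bound the truncation error for \<open>N\<close>,
  as for \<open>M n\<close>, by a multiple of \<open>1 / R\<close>. Letting \<open>R\<close> tend to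
  infinity then gives equality for all moments.\<close>

lemma weak_limit_has_moments:
  assumes M: "\<And>n. real_distribution (M n)" and N: "real_distribution N"
    and weak: "weak_conv_m M N"
    and int: "\<And>n k. integrable (M n) (\<lambda>x. x ^ k)"
    and ev: "\<And>k. \<forall>\<^sub>F n in sequentially. (LINT x|M n. x ^ k) = s k"
  shows "has_moments N s"
proof -
  interpret N: real_distribution N by (rule N)
  interpret M: real_distribution "M n" for n by (rule M)
  have conv: "(\<lambda>n. LINT x|M n. clamp_at R x ^ k) \<longlonglongrightarrow> (LINT x|N. clamp_at R x ^ k)" if "0 \<le> R" for R k
    by (rule weak_conv_imp_integral_bdd_continuous_conv[OF M N weak, where B = "R ^ k"])
       (use clamp_at_continuous clamp_at_bound[OF that] in auto)
  have intc: "integrable N (\<lambda>x. clamp_at R x ^ k)" "integrable (M n) (\<lambda>x. clamp_at R x ^ k)" if "0 \<le> R" for R n k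
    using clamp_at_bound[OF that]
    by (auto intro!: N.integrable_const_bound[where B = "R ^ k"] M.integrable_const_bound[where B = "R ^ k"])
  have even: "integrable N (\<lambda>x. x ^ (2 * k)) \<and> (LINT x|N. x ^ (2 * k)) \<le> s (2 * k)" for k
  proof -
    define u where "u m x = clamp_at (real m) x ^ (2 * k)" for m x
    have u_int: "integrable N (u m)" for m unfolding u_def by (rule intc) simp
    have u_mono: "u m x \<le> u m' x" if "m \<le> m'" for m m' x
    proof -
      have "\<bar>clamp_at (real m) x\<bar> \<le> \<bar>clamp_at (real m') x\<bar>"
        using that by (auto simp: clamp_at_def)
      then have "\<bar>clamp_at (real m) x\<bar> ^ (2 * k) \<le> \<bar>clamp_at (real m') x\<bar> ^ (2 * k)"
        by (intro power_mono) auto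
      then show ?thesis by (simp add: u_def power_mult)
    qed
    have u_le: "(LINT x|N. u m x) \<le> s (2 * k)" for m
    proof (rule LIMSEQ_le_const2)
      show "(\<lambda>n. LINT x|M n. u m x) \<longlonglongrightarrow> (LINT x|N. u m x)"
        unfolding u_def by (rule conv) simp
      have "\<forall>\<^sub>F n in sequentially. (LINT x|M n. u m x) \<le> s (2 * k)"
        using ev[of "2 * k"]
      proof eventually_elim
        case (elim n)
        have "(LINT x|M n. u m x) \<le> (LINT x|M n. x ^ (2 * k))"
        proof (rule integral_mono)
          show "integrable (M n) (u m)" unfolding u_def by (rule intc) simp
          fix x
          have "\<bar>clamp_at (real m) x\<bar> ^ (2 * k) \<le> \<bar>x\<bar> ^ (2 * k)"
            by (intro power_mono) (auto simp: clamp_at_def)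
          then show "u m x \<le> x ^ (2 * k)" by (simp add: u_def power_mult)
        qed (rule int)
        then show ?case using elim by simp
      qed
      then show "\<exists>n0. \<forall>n\<ge>n0. (LINT x|M n. u m x) \<le> s (2 * k)"
        by (simp add: eventually_sequentially)
    qed
    have "incseq (\<lambda>m. LINT x|N. u m x)"
      by (intro incseq_SucI integral_mono u_int u_mono) auto
    then obtain L where L: "(\<lambda>m. LINT x|N. u m x) \<longlonglongrightarrow> L"
      using incseq_convergent[of "\<lambda>m. LINT x|N. u m x" "s (2 * k)"] u_le by blast
    have lim: "(\<lambda>m. u m x) \<longlonglongrightarrow> x ^ (2 * k)" for x
    proof (rule tendsto_eventually)
      obtain m0 :: nat where "\<bar>x\<bar> \<le> real m0" using real_arch_simple by blast
      then have "u m x = x ^ (2 * k)" if "m \<ge> m0" for m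
        using that by (auto simp: u_def clamp_at_def)
      then show "\<forall>\<^sub>F m in sequentially. u m x = x ^ (2 * k)"
        by (auto simp: eventually_sequentially)
    qed
    have mono: "AE x in N. mono (\<lambda>m. u m x)"
      by (intro AE_I2 monoI u_mono)
    have lim': "AE x in N. (\<lambda>m. u m x) \<longlonglongrightarrow> x ^ (2 * k)" using lim by simp
    have meas: "(\<lambda>x. x ^ (2 * k)) \<in> borel_measurable N" by simp
    have "integrable N (\<lambda>x. x ^ (2 * k))"
      by (rule integrable_monotone_convergence[OF u_int mono lim' L meas])
    moreover have "(LINT x|N. x ^ (2 * k)) = L"
      by (rule integral_monotone_convergence[OF u_int mono lim' L meas])
    moreover have "L \<le> s (2 * k)" using L u_le by (intro LIMSEQ_le_const2[OF L]) auto
    ultimately show ?thesis by simp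
  qed
  have intN: "integrable N (\<lambda>x. x ^ k)" for k
  proof (rule Bochner_Integration.integrable_bound)
    show "integrable N (\<lambda>x. 1 + x ^ (2 * k))" using even[of k] by simp
    have "\<bar>x ^ k\<bar> \<le> 1 + x ^ (2 * k)" for x :: real
    proof -
      have "0 \<le> (\<bar>x ^ k\<bar> - 1)\<^sup>2" by simp
      then have "2 * \<bar>x ^ k\<bar> \<le> 1 + \<bar>x ^ k\<bar>\<^sup>2" by (simp add: power2_diff)
      also have "\<bar>x ^ k\<bar>\<^sup>2 = x ^ (2 * k)" by (simp add: power_mult[symmetric] mult.commute)
      finally show ?thesis by linarith
    qed
    then show "AE x in N. norm (x ^ k) \<le> norm (1 + x ^ (2 * k))"
      by (auto intro: order_trans[OF _ abs_ge_self])
  qed simp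
  have "(LINT x|N. x ^ k) = s k" for k
  \<comment> \<open>The error estimate decays through \<open>R \<le> R ^ k\<close>, which fails for
    \<open>k = 0\<close> and \<open>R > 1\<close>.\<close>
  proof (cases "k = 0")
    case True
    have "s 0 = 1"
      using ev[of 0] M.prob_space by (auto simp: eventually_sequentially)
    then show ?thesis using True N.prob_space by simp
  next
    case False
    define S where "S = s (2 * k)"
    have err: "\<bar>(LINT x|Q. x ^ k) - (LINT x|Q. clamp_at R x ^ k)\<bar> \<le> S / R"
      if "1 \<le> R" "integrable Q (\<lambda>x. x ^ k)" "integrable Q (\<lambda>x. clamp_at R x ^ k)"
        "integrable Q (\<lambda>x. x ^ (2 * k))" "(LINT x|Q. x ^ (2 * k)) \<le> S" for Q R
    proof -
      have "\<bar>(LINT x|Q. x ^ k) - (LINT x|Q. clamp_at R x ^ k)\<bar> = \<bar>LINT x|Q. x ^ k - clamp_at R x ^ k\<bar>"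
        using that by simp
      also have "\<dots> \<le> (LINT x|Q. \<bar>x ^ k - clamp_at R x ^ k\<bar>)" by (rule integral_abs_bound)
      also have "\<dots> \<le> (LINT x|Q. x ^ (2 * k) / R ^ k)"
        using that by (intro integral_mono clamp_at_error) auto
      also have "\<dots> = (LINT x|Q. x ^ (2 * k)) / R ^ k" by simp
      also have "\<dots> \<le> (LINT x|Q. x ^ (2 * k)) / R"
      proof (rule divide_left_mono)
        show "R \<le> R ^ k" using that(1) False self_le_power[of R k] by simp
        show "0 \<le> (LINT x|Q. x ^ (2 * k))" by (rule Bochner_Integration.integral_nonneg) (simp add: power_mult)
      qed (use that(1) in simp)
      also have "\<dots> \<le> S / R" using that by (intro divide_right_mono) auto
      finally show ?thesis .
    qed
    have le: "\<bar>(LINT x|N. x ^ k) - s k\<bar> \<le> 2 * S / R" if R: "1 \<le> R" for R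
    proof -
      have c: "(\<lambda>n. \<bar>(LINT x|M n. clamp_at R x ^ k) - s k\<bar>) \<longlonglongrightarrow> \<bar>(LINT x|N. clamp_at R x ^ k) - s k\<bar>"
        using R by (intro tendsto_intros conv) simp
      have "\<forall>\<^sub>F n in sequentially. \<bar>(LINT x|M n. clamp_at R x ^ k) - s k\<bar> \<le> S / R"
        using ev[of k] ev[of "2 * k"]
      proof eventually_elim
        case (elim n)
        have "\<bar>(LINT x|M n. x ^ k) - (LINT x|M n. clamp_at R x ^ k)\<bar> \<le> S / R"
          using R elim int by (intro err intc) (auto simp: S_def)
        then show ?case using elim by (simp add: abs_minus_commute)
      qed
      then have "\<bar>(LINT x|N. clamp_at R x ^ k) - s k\<bar> \<le> S / R"
        by (intro LIMSEQ_le_const2[OF c]) (simp add: eventually_sequentially)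
      moreover have "\<bar>(LINT x|N. x ^ k) - (LINT x|N. clamp_at R x ^ k)\<bar> \<le> S / R"
        using R even[of k] by (intro err intc intN) (auto simp: S_def)
      ultimately show ?thesis by simp
    qed
    have "((\<lambda>R. 2 * S / R) \<longlongrightarrow> 0) at_top" by real_asymp
    moreover have "\<forall>\<^sub>F R in at_top. \<bar>(LINT x|N. x ^ k) - s k\<bar> \<le> 2 * S / R"
      using eventually_ge_at_top[of 1] by eventually_elim (rule le)
    ultimately have "\<bar>(LINT x|N. x ^ k) - s k\<bar> \<le> 0"
      by (rule tendsto_lowerbound) simp
    then show ?thesis by simp
  qed
  then show ?thesis using intN by (simp add: has_moments_def)
qed

text \<open>A point mass is not the integral of a continuous function, so tents of height
  \<open>1\<close> at \<open>x0\<close> and shrinking width are used; continuity from above leads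
  from the balls \<open>A m\<close> to \<open>{x0}\<close>. The hypothesis \<open>atom\<close>
  expresses the mass bound in integrated form.\<close>

lemma weak_limit_atom:
  assumes M: "\<And>n. real_distribution (M n)" and N: "real_distribution N"
    and weak: "weak_conv_m M N"
    and atom: "\<And>n g. g \<in> borel_measurable borel \<Longrightarrow> (\<And>x. 0 \<le> g x) \<Longrightarrow> c * g x0 \<le> (LINT x|M n. (g x::real))"
  shows "c \<le> measure N {x0}"
proof -
  interpret N: real_distribution N by (rule N)
  define A where "A m = cball x0 (1 / real (Suc m))" for m
  have "c \<le> measure N (A m)" for m
  proof -
    define g where "g x = max 0 (1 - real (Suc m) * \<bar>x - x0\<bar>)" for x
    have cont: "isCont g x" for x unfolding g_def by (intro continuous_intros)
    have meas: "g \<in> borel_measurable borel" unfolding g_def by measurable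
    have bd: "\<bar>g x\<bar> \<le> 1" "0 \<le> g x" for x by (auto simp: g_def)
    have "c \<le> (LINT x|N. g x)"
    proof (rule LIMSEQ_le_const)
      show "(\<lambda>n. LINT x|M n. g x) \<longlonglongrightarrow> (LINT x|N. g x)"
        by (rule weak_conv_imp_integral_bdd_continuous_conv[OF M N weak, where B = 1]) (use cont bd in auto)
      show "\<exists>n0. \<forall>n\<ge>n0. c \<le> (LINT x|M n. g x)"
        using atom[OF meas bd(2)] by (simp add: g_def)
    qed
    also have "\<dots> \<le> (LINT x|N. indicator (A m) x)"
    proof (rule integral_mono)
      show "integrable N g" using bd(1) meas by (intro N.integrable_const_bound[where B = 1]) auto
      show "g x \<le> indicator (A m) x" for x
        by (auto simp: g_def A_def indicator_def dist_real_def abs_minus_commute field_simps)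
      show "integrable N (indicator (A m) :: real \<Rightarrow> real)"
        by (intro integrable_real_indicator) (auto simp: A_def N.emeasure_finite less_top[symmetric])
    qed
    also have "\<dots> = measure N (A m)" by (simp add: A_def)
    finally show ?thesis .
  qed
  moreover have "(\<lambda>m. measure N (A m)) \<longlonglongrightarrow> measure N (\<Inter>m. A m)"
  proof (rule N.finite_Lim_measure_decseq)
    show "decseq A" unfolding A_def by (intro decseq_SucI subset_cball) (simp add: field_simps)
  qed (auto simp: A_def)
  moreover have "(\<Inter>m. A m) = {x0}"
  proof
    show "(\<Inter>m. A m) \<subseteq> {x0}"
    proof
      fix x assume "x \<in> (\<Inter>m. A m)"
      then have "dist x0 x \<le> 1 / real (Suc m)" for m by (auto simp: A_def)
      then have "dist x0 x \<le> 0"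
        using LIMSEQ_le_const[OF LIMSEQ_inverse_real_of_nat, of "dist x0 x"] by (auto simp: inverse_eq_divide)
      then show "x \<in> {x0}" by simp
    qed
  qed (auto simp: A_def)
  ultimately show ?thesis by (metis LIMSEQ_le_const)
qed

section \<open>Solutions with a prescribed atom and indeterminacy\<close>

context hamburger
begin

text \<open>Since \<open>S\<close> is the full sum, \<open>1 / S\<close> bounds the weights at
  \<open>x0\<close> of all quadratures at once, so this mass survives in the limit.\<close>

lemma ex_solution_with_atom:
  assumes x0: "\<And>n. poly (P n) x0 \<noteq> 0" and sm: "summable (\<lambda>n. (poly (P n) x0)\<^sup>2)"
  shows "\<exists>N. has_moments N s \<and> 0 < measure N {x0}"
proof -
  define S where "S = (\<Sum>n. (poly (P n) x0)\<^sup>2)"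
  have "sum (\<lambda>n. (poly (P n) x0)\<^sup>2) {0} \<le> S" unfolding S_def using sm by (intro sum_le_suminf) auto
  then have S: "1 \<le> S" by (simp add: P_0)
  have "\<exists>M. real_distribution M \<and> (\<forall>g\<in>borel_measurable borel. integrable M (g :: real \<Rightarrow> real)) \<and>
      (\<forall>k\<le>2 * n. (LINT x|M. x ^ k) = s k) \<and>
      (\<forall>g\<in>borel_measurable borel. (\<forall>x. 0 \<le> g x) \<longrightarrow> 1 / S * g x0 \<le> (LINT x|M. (g x::real)))" for n
  proof -
    obtain X w where X: "finite X" "x0 \<in> X" "\<And>t. t \<in> X \<Longrightarrow> 0 \<le> w t"
      and exact: "\<And>p. degree p \<le> 2 * n \<Longrightarrow> \<Lambda> p = (\<Sum>t\<in>X. w t * poly p t)"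
      and wx0: "1 \<le> w x0 * (\<Sum>k\<le>n. (poly (P k) x0)\<^sup>2)"
      using gauss_quadrature[OF x0[of n]] by blast
    have mom: "(\<Sum>t\<in>X. w t * t ^ k) = s k" if "k \<le> 2 * n" for k
      using exact[of "monom 1 k"] that by (simp add: degree_monom_eq \<Lambda>_monom poly_monom)
    have "(\<Sum>t\<in>X. w t) = 1" using mom[of 0] by (simp add: s_0)
    from ex_finite_distribution[OF X(1,3) this] obtain M where M: "real_distribution M"
      "\<And>g::real\<Rightarrow>real. g \<in> borel_measurable borel \<Longrightarrow> integrable M g \<and> (LINT x|M. g x) = (\<Sum>t\<in>X. w t * g t)"
      by auto
    have "(\<Sum>k\<le>n. (poly (P k) x0)\<^sup>2) \<le> S" unfolding S_def using sm by (intro sum_le_suminf) auto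
    then have "w x0 * (\<Sum>k\<le>n. (poly (P k) x0)\<^sup>2) \<le> w x0 * S" using X by (intro mult_left_mono) auto
    with wx0 have wS: "1 / S \<le> w x0" using S by (simp add: field_simps)
    have "1 / S * g x0 \<le> (LINT x|M. g x)"
      if g: "g \<in> borel_measurable borel" "\<forall>x. 0 \<le> g x" for g :: "real \<Rightarrow> real"
    proof -
      have "1 / S * g x0 \<le> w x0 * g x0" using wS g by (intro mult_right_mono) auto
      also have "\<dots> \<le> (\<Sum>t\<in>X. w t * g t)" using X g by (intro member_le_sum) auto
      finally show ?thesis using M(2)[OF g(1)] by simp
    qed
    then show ?thesis using M mom by (intro exI[of _ M]) auto
  qed
  then obtain M where M: "\<And>n. real_distribution (M n)"
     "\<And>n g. g \<in> borel_measurable borel \<Longrightarrow> integrable (M n) (g :: real \<Rightarrow> real)"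
     "\<And>n k. k \<le> 2 * n \<Longrightarrow> (LINT x|M n. x ^ k) = s k"
     "\<And>n g. g \<in> borel_measurable borel \<Longrightarrow> (\<And>x. 0 \<le> g x) \<Longrightarrow> 1 / S * g x0 \<le> (LINT x|M n. (g x::real))"
    by metis
  \<comment> \<open>The shift makes the second moment equal to \<open>s 2\<close> already for the
    first measure, as the tightness criterion asks of all of them.\<close>
  define M' where "M' n = M (Suc n)" for n
  have "tight M'"
    by (rule tight_if_second_moment[where B = "s 2"]) (auto simp: M'_def M)
  then obtain r N where r: "strict_mono r" and N: "real_distribution N" and weak: "weak_conv_m (M' \<circ> id \<circ> r) N"
    using tight_imp_convergent_subsubsequence[of M' id] by (auto simp: strict_mono_def)
  have M'': "real_distribution ((M' \<circ> id \<circ> r) n)" for n by (simp add: M'_def M)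
  have "has_moments N s"
  proof (rule weak_limit_has_moments[OF M'' N weak])
    show "integrable ((M' \<circ> id \<circ> r) n) (\<lambda>x. x ^ k)" for n k by (simp add: M'_def M)
    show "\<forall>\<^sub>F n in sequentially. (LINT x|(M' \<circ> id \<circ> r) n. x ^ k) = s k" for k
      using eventually_ge_at_top[of k]
    proof eventually_elim
      case (elim n)
      then have "k \<le> 2 * Suc (r n)" using seq_suble[OF r, of n] by simp
      then show ?case by (simp add: M'_def M)
    qed
  qed
  moreover have "1 / S \<le> measure N {x0}"
  proof (rule weak_limit_atom[OF M'' N weak])
    fix n and g :: "real \<Rightarrow> real"
    assume g: "g \<in> borel_measurable borel" "\<And>x. 0 \<le> g x"
    show "1 / S * g x0 \<le> (LINT x|(M' \<circ> id \<circ> r) n. g x)"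
      unfolding M'_def o_apply id_apply by (rule M(4)[of g "Suc (r n)", OF g])
  qed
  moreover have "0 < 1 / S" using S by simp
  ultimately show ?thesis by (meson less_le_trans)
qed

lemma indeterminate_if_summable:
  assumes sm: "\<And>x. summable (\<lambda>n. (poly (P n) x)\<^sup>2)"
  shows "indeterminate s"
proof (rule ccontr)
  assume "\<not> indeterminate s"
  then have uniq: "N = \<mu>" if "has_moments N s" for N
    using that moments unfolding indeterminate_def by blast
  interpret prob_space \<mu> by (rule prob)
  \<comment> \<open>The zeros are set aside because each quadrature needs \<open>P n\<close> to be
    nonzero at its prescribed node.\<close>
  define Z where "Z = (\<Union>n. {x. poly (P n) x = 0})"
  have P_nz: "P n \<noteq> 0" for n using lead_P[of n] by (metis coeff_0 less_irrefl)
  have "countable {x. poly (P n) x = 0}" for n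
    using P_nz[of n] by (intro countable_finite poly_roots_finite)
  then have "countable Z"
    unfolding Z_def by (rule countable_UN[OF countableI_type])
  moreover have "- Z \<subseteq> {x. measure \<mu> {x} \<noteq> 0}"
  proof
    fix x0 assume "x0 \<in> - Z"
    then have "\<And>n. poly (P n) x0 \<noteq> 0" by (auto simp: Z_def)
    then obtain N where "has_moments N s" "0 < measure N {x0}"
      using ex_solution_with_atom[OF _ sm] by blast
    then show "x0 \<in> {x. measure \<mu> {x} \<noteq> 0}" using uniq by auto
  qed
  then have "countable (- Z)" using countable_support countable_subset by blast
  ultimately have "countable (Z \<union> - Z)" by (rule countable_Un)
  then show False using uncountable_UNIV_real by (simp add: Compl_partition)
qed

end

theorem theorem7p5:
  fixes \<mu> :: "real measure" and s :: "nat \<Rightarrow> real"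
    and P :: "nat \<Rightarrow> real poly" and a b :: "nat \<Rightarrow> real"
  assumes "normalized_Hamburger \<mu> s"
    and "orthonormal_polys \<mu> P"
    and "recurrence_coeffs P a b"
    and "summable (\<lambda>n. (1 + \<bar>a (Suc n)\<bar>) / sqrt (b (Suc n) * b n))"
    and "\<exists>n0\<ge>1. (\<forall>n\<ge>n0. (b n)\<^sup>2 \<le> b (n - 1) * b (n + 1)) \<or>
                (\<forall>n\<ge>n0. (b n)\<^sup>2 \<ge> b (n - 1) * b (n + 1))"
  shows "indeterminate s \<and>
    (growth_order (P_fun P) = growth_order (F_fun s) \<and>
     growth_order (F_fun s) = growth_order (G_fun b) \<and>
     growth_order (G_fun b) = growth_order (H_fun b) \<and>
     growth_order (H_fun b) = growth_order (L_fun s) \<and>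
     growth_order (L_fun s) = conv_exponent b) \<and>
    (growth_order (P_fun P) = 0 \<longrightarrow>
     log_order (P_fun P) = log_order (F_fun s) \<and>
     log_order (F_fun s) = log_order (G_fun b) \<and>
     log_order (G_fun b) = log_order (H_fun b) \<and>
     log_order (H_fun b) = log_order (L_fun s) \<and>
     log_order (L_fun s) = conv_exponent (\<lambda>n. ln (b n))) \<and>
    (log_order (P_fun P) = 0 \<longrightarrow>
     loglog_order (P_fun P) = loglog_order (F_fun s) \<and>
     loglog_order (F_fun s) = loglog_order (G_fun b) \<and>
     loglog_order (G_fun b) = loglog_order (H_fun b) \<and>
     loglog_order (H_fun b) = loglog_order (L_fun s) \<and>
     loglog_order (L_fun s) = conv_exponent (\<lambda>n. ln (ln (b n))))"
proof -
  interpret hamburger \<mu> s P a b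
    by standard (fact assms)+
  have reg: "log_regular b" using assms(5) by (simp add: log_regular_def)
  have "summable (\<lambda>n. 1 / sqrt (b (Suc n) * b n))"
  proof (rule summable_comparison_test[OF _ assms(4)])
    show "\<exists>N. \<forall>n\<ge>N. norm (1 / sqrt (b (Suc n) * b n)) \<le> (1 + \<bar>a (Suc n)\<bar>) / sqrt (b (Suc n) * b n)"
      using b_pos by (auto simp: less_imp_le intro!: divide_right_mono)
  qed
  then obtain K where "almost_increasing b K"
    using log_regular_almost_increasing[OF b_pos _ reg] by blast
  then interpret regular_hamburger \<mu> s P a b K
    using reg assms(4)
    by (intro regular_hamburger.intro regular_hamburger_axioms.intro hamburger_axioms)
  have "summable (\<lambda>n. (poly (P n) x)\<^sup>2)" for x
    using summable_cpoly_P[of "of_real x"] by (simp add: cpoly_of_real)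
  then have "indeterminate s" by (rule indeterminate_if_summable)
  then show ?thesis
    by (simp add: growth_orders log_orders loglog_orders)
qed

end
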